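(* Let $\nu\ge 0$, $t>0$ and $\alpha\in\mathbb{R}$. The conditional characteristic function of $X_\nu(t)$ is, for every integer $n\ge 1$, $$E\left\{e^{i\alpha X_\nu(t)}\,\middle|\,N(t)=n\right\}=\frac{n!}{t^n}\left(2^\nu\Gamma(\nu+1)\right)^{n+1}\int_0^t ds_1\int_{s_1}^t ds_2\cdots\int_{s_{n-1}}^t ds_n\prod_{j=1}^{n+1}\frac{J_\nu(\alpha c(s_j-s_{j-1}))}{(\alpha c(s_j-s_{j-1}))^\nu},$$ where $s_0=0$ and $s_{n+1}=t$, while for $n=0$ $$E\left\{e^{i\alpha X_\nu(t)}\,\middle|\,N(t)=0\right\}=\left(\frac{2}{\alpha ct}\right)^\nu\Gamma(\nu+1)J_\nu(\alpha ct).$$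
   Context: Fix $c>0$, $\lambda>0$. For $\nu\ge0$ let $f_\nu(\theta)=\frac{\Gamma(\nu+1)}{\sqrt{\pi}\,\Gamma(\nu+\frac12)}\sin^{2\nu}\theta$, $\theta\in(0,\pi)$, a probability density. Let $N(t)$ be a homogeneous Poisson process of rate $\lambda$ with event times $s_1<s_2<\cdots$, and let $\theta_1,\theta_2,\dots$ be i.i.d. with density $f_\nu$, independent of $N$. The random motion is $X_\nu(t)=c\sum_{j=1}^{N(t)+1}(s_j-s_{j-1})\cos\theta_j$, with the conventions $s_0=0$ and $s_{N(t)+1}=t$. $J_\nu(x)=\sum_{k=0}^\infty(-1)^k\frac{(x/2)^{2k+\nu}}{\Gamma(k+1)\Gamma(k+\nu+1)}$ is the Bessel function. The quotient $J_\nu(z)/z^\nu$ is understood as the even entire function $2^{-\nu}\sum_{k\ge0}(-1)^k\frac{(z/2)^{2k}}{k!\,\Gamma(k+\nu+1)}$ (in particular also for $z\le0$). *)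

theory Defs
  imports "HOL-Probability.Probability"
begin

text \<open>
  A homogeneous Poisson process on the time axis \<open>[0, \<infinity>)\<close>: a counting process started at 0 with
  independent, Poisson distributed increments. The values of \<open>N\<close> at negative times are irrelevant.
  Since paths are nondecreasing, the truncated subtraction on \<^typ>\<open>nat\<close> is the true increment.
\<close>

definition poisson_process :: "'a measure \<Rightarrow> real \<Rightarrow> (real \<Rightarrow> 'a \<Rightarrow> nat) \<Rightarrow> bool" where
  "poisson_process M rate N \<longleftrightarrow>
     prob_space M \<and> 0 < rate \<and>
     (\<forall>u\<ge>0. N u \<in> M \<rightarrow>\<^sub>M count_space UNIV) \<and>
     (\<forall>\<omega>\<in>space M. N 0 \<omega> = 0) \<and>
     (\<forall>\<omega>\<in>space M. \<forall>u v. 0 \<le> u \<longrightarrow> u \<le> v \<longrightarrow> N u \<omega> \<le> N v \<omega>) \<and>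
     (\<forall>\<omega>\<in>space M. \<forall>u\<ge>0. continuous (at_right u) (\<lambda>v. N v \<omega>)) \<and>
     (\<forall>u v. 0 \<le> u \<longrightarrow> u < v \<longrightarrow>
        distr M (count_space UNIV) (\<lambda>\<omega>. N v \<omega> - N u \<omega>) = measure_pmf (poisson_pmf (rate * (v - u)))) \<and>
     (\<forall>(n::nat) u. 0 \<le> u 0 \<longrightarrow> (\<forall>k<n. u k < u (Suc k)) \<longrightarrow>
        prob_space.indep_vars M (\<lambda>_. count_space UNIV) (\<lambda>k \<omega>. N (u (Suc k)) \<omega> - N (u k) \<omega>) {..<n})"

text \<open>
  The \<open>j\<close>-th event time \<open>s\<^sub>j\<close>; below it is only evaluated for \<open>j \<le> N t \<omega>\<close>, where the set is nonempty.
\<close>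

definition event_time :: "(real \<Rightarrow> 'a \<Rightarrow> nat) \<Rightarrow> nat \<Rightarrow> 'a \<Rightarrow> real" where
  "event_time N j \<omega> = Inf {u. 0 \<le> u \<and> j \<le> N u \<omega>}"

lemma event_time_0: "event_time N 0 \<omega> = 0"
  by (simp add: event_time_def flip: atLeast_def)

definition event_time_upto :: "(real \<Rightarrow> 'a \<Rightarrow> nat) \<Rightarrow> real \<Rightarrow> nat \<Rightarrow> 'a \<Rightarrow> real" where
  "event_time_upto N t j \<omega> = (if j = N t \<omega> + 1 then t else event_time N j \<omega>)"

definition random_motion ::
  "real \<Rightarrow> (real \<Rightarrow> 'a \<Rightarrow> nat) \<Rightarrow> (nat \<Rightarrow> 'a \<Rightarrow> real) \<Rightarrow> real \<Rightarrow> 'a \<Rightarrow> real" where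
  "random_motion c N \<theta> t \<omega> =
     c * (\<Sum>j=1..N t \<omega> + 1.
            (event_time_upto N t j \<omega> - event_time_upto N t (j - 1) \<omega>) * cos (\<theta> j \<omega>))"

text \<open>
  Independence of two random elements with values in possibly different types (the library's
  \<open>indep_var\<close> needs equal types): independence of the generated sigma-algebras.
\<close>

definition indep_elements ::
  "'a measure \<Rightarrow> 'b measure \<Rightarrow> ('a \<Rightarrow> 'b) \<Rightarrow> 'c measure \<Rightarrow> ('a \<Rightarrow> 'c) \<Rightarrow> bool" where
  "indep_elements M S X T Y \<longleftrightarrow>
     prob_space.indep_set M
       (sets (vimage_algebra (space M) X S)) (sets (vimage_algebra (space M) Y T))"

definition angle_density :: "real \<Rightarrow> real \<Rightarrow> real" where
  "angle_density \<nu> x =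
     indicator {0<..<pi} x * (Gamma (\<nu> + 1) / (sqrt pi * Gamma (\<nu> + 1/2)) * sin x powr (2 * \<nu>))"

text \<open>Conditional expectation given an event of positive probability.\<close>

definition cond_expectation :: "'a measure \<Rightarrow> ('a \<Rightarrow> complex) \<Rightarrow> 'a set \<Rightarrow> complex" where
  "cond_expectation M Y A = (LINT \<omega>|uniform_measure M A. Y \<omega>)"

text \<open>
  The real power \<open>powr\<close> makes the following series meaningful for \<open>x > 0\<close> only (note that
  \<open>0 powr 0 = 0\<close>). The quotient of \<open>J\<^sub>\<nu> z\<close> by \<open>z\<^sup>\<nu>\<close> is therefore given for all real \<open>z\<close> by its own power
  series, which is the even entire extension; see \<open>bessel_J_quot_eq\<close>.
\<close>

definition bessel_J :: "real \<Rightarrow> real \<Rightarrow> real" where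
  "bessel_J \<nu> x =
     (\<Sum>k. (-1) ^ k * (x / 2) powr (2 * real k + \<nu>) / (Gamma (real k + 1) * Gamma (real k + \<nu> + 1)))"

definition bessel_J_quot :: "real \<Rightarrow> real \<Rightarrow> real" where
  "bessel_J_quot \<nu> z =
     2 powr (-\<nu>) * (\<Sum>k. (-1) ^ k * (z / 2) ^ (2 * k) / (fact k * Gamma (real k + \<nu> + 1)))"

lemma bessel_J_quot_summable:
  fixes \<nu> z :: real
  assumes "\<nu> \<ge> 0"
  shows "summable (\<lambda>k. (-1) ^ k * (z / 2) ^ (2 * k) / (fact k * Gamma (real k + \<nu> + 1)))"
proof (rule summable_comparison_test')
  show "summable (\<lambda>k. 1 / Gamma (\<nu> + 1) * (inverse (fact k) * ((z / 2)\<^sup>2) ^ k))"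
    by (intro summable_mult summable_exp)
next
  fix k :: nat
  have Gamma_mono: "Gamma (\<nu> + 1) \<le> Gamma (real k + \<nu> + 1)"
  proof (induction k)
    case (Suc k)
    have p: "Gamma (real k + \<nu> + 1) > 0"
      using assms by (intro Gamma_real_pos) auto
    have "Gamma (real (Suc k) + \<nu> + 1) = (real k + \<nu> + 1) * Gamma (real k + \<nu> + 1)"
      using Gamma_plus1[of "real k + \<nu> + 1"] assms
      by (force simp: add_ac elim!: nonpos_Ints_cases)
    also have "\<dots> \<ge> 1 * Gamma (real k + \<nu> + 1)"
      using p assms by (intro mult_right_mono) auto
    finally show ?case using Suc by simp
  qed simp
  have pos: "Gamma (\<nu> + 1) > 0"
    using assms by (intro Gamma_real_pos) auto
  have "norm ((-1) ^ k * (z / 2) ^ (2 * k) / (fact k * Gamma (real k + \<nu> + 1)))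
      = ((z / 2)\<^sup>2) ^ k / (fact k * Gamma (real k + \<nu> + 1))"
    using pos Gamma_mono by (simp add: abs_mult power_abs power_mult power_divide)
  also have "\<dots> \<le> ((z / 2)\<^sup>2) ^ k / (fact k * Gamma (\<nu> + 1))"
    using pos Gamma_mono by (intro divide_left_mono mult_left_mono mult_pos_pos) auto
  finally show "norm ((-1) ^ k * (z / 2) ^ (2 * k) / (fact k * Gamma (real k + \<nu> + 1)))
      \<le> 1 / Gamma (\<nu> + 1) * (inverse (fact k) * ((z / 2)\<^sup>2) ^ k)"
    by (simp add: field_simps)
qed

lemma bessel_J_quot_eq:
  fixes \<nu> z :: real
  assumes "\<nu> \<ge> 0" and "z > 0"
  shows "bessel_J_quot \<nu> z = bessel_J \<nu> z / z powr \<nu>"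
proof -
  have "(z / 2) powr (2 * real k + \<nu>) = (z powr \<nu> * 2 powr (-\<nu>)) * (z / 2) ^ (2 * k)" for k
    using assms by (simp add: powr_add powr_divide powr_minus field_simps flip: powr_realpow)
  then have "bessel_J \<nu> z = (\<Sum>k. (z powr \<nu> * 2 powr (-\<nu>)) *
      ((-1) ^ k * (z / 2) ^ (2 * k) / (fact k * Gamma (real k + \<nu> + 1))))"
    unfolding bessel_J_def
    by (intro suminf_cong) (simp add: Gamma_fact add.commute)
  also have "\<dots> = z powr \<nu> * bessel_J_quot \<nu> z"
    by (subst suminf_mult) (use bessel_J_quot_summable[OF assms(1)] in
        \<open>auto simp: bessel_J_quot_def\<close>)
  finally show ?thesis using assms by simp
qed

text \<open>
  \<open>ordered_integral n a t F\<close> is the iterated integral of \<open>F [s\<^sub>1, \<dots>, s\<^sub>n]\<close> with \<open>s\<^sub>1\<close> ranging over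
  \<open>[a, t]\<close> (outermost), \<open>s\<^sub>2\<close> over \<open>[s\<^sub>1, t]\<close>, and so on up to \<open>s\<^sub>n\<close> (innermost).
\<close>

primrec ordered_integral :: "nat \<Rightarrow> real \<Rightarrow> real \<Rightarrow> (real list \<Rightarrow> real) \<Rightarrow> real" where
  "ordered_integral 0 a t F = F []"
| "ordered_integral (Suc n) a t F = (LINT x:{a..t}|lborel. ordered_integral n x t (\<lambda>xs. F (x # xs)))"

end

theory Submission
  imports Defs
begin

text \<open>
  Cut \<open>[0, t]\<close> into \<open>m\<close> equal cells. If no cell contains two events, then \<open>N t = n\<close> together with the
  cells of the \<open>n\<close> events is the event that the increments of \<open>N\<close> over the cells are prescribed zeros
  and ones, which has probability \<open>e\<^bsup>-\<lambda>t\<^esup> (\<lambda>t/m)\<^sup>n\<close>. On it replace every event time by the right end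
  of its cell: by independence the characteristic function becomes a sum over cells of products of
  \<open>E exp (\<i> z cos \<theta>)\<close>, and the same sum is the average of a step function under \<open>n\<close> independent uniform
  points. Let \<open>m \<rightarrow> \<infinity>\<close> by dominated convergence on both sides. That simultaneous events have probability
  zero is the case \<open>\<alpha> = 0\<close> of the resulting identity, since \<open>P(N t = n)\<close> is known. Finally,
  \<open>E exp (\<i> z cos \<theta>) = 2\<^sup>\<nu> \<Gamma>(\<nu> + 1) J\<^sub>\<nu>(z) / z\<^sup>\<nu>\<close> follows by comparing power series, the moments of \<open>cos \<theta>\<close>
  being determined by a two-step recursion.
\<close>

section \<open>Characteristic function of the cosine of the angle\<close>

lemma angle_density_nonneg:
  assumes "\<nu> \<ge> 0"
  shows "angle_density \<nu> x \<ge> 0"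
  using assms Gamma_real_pos[of "\<nu> + 1"] Gamma_real_pos[of "\<nu> + 1/2"]
  by (auto simp: angle_density_def)

lemma borel_measurable_angle_density [measurable]: "angle_density \<nu> \<in> borel_measurable borel"
  unfolding angle_density_def by measurable

text \<open>On the support \<open>sin x\<close> lies in [0, 1] and the exponent is nonnegative, so a
  multiple of an interval indicator dominates the density. This majorant makes every cosine moment
  finite.\<close>

lemma angle_density_le:
  assumes "\<nu> \<ge> 0"
  shows "angle_density \<nu> x \<le> Gamma (\<nu> + 1) / (sqrt pi * Gamma (\<nu> + 1/2)) * indicator {0..pi} x"
proof (cases "x \<in> {0<..<pi}")
  case True
  have "sin x powr (2 * \<nu>) \<le> 1 powr (2 * \<nu>)"
    using assms True by (intro powr_mono2) (auto intro!: sin_ge_zero)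
  then have "Gamma (\<nu> + 1) / (sqrt pi * Gamma (\<nu> + 1/2)) * sin x powr (2 * \<nu>)
      \<le> Gamma (\<nu> + 1) / (sqrt pi * Gamma (\<nu> + 1/2)) * 1"
    using assms Gamma_real_pos[of "\<nu> + 1"] Gamma_real_pos[of "\<nu> + 1/2"]
    by (intro mult_left_mono) auto
  with True show ?thesis by (simp add: angle_density_def)
next
  case False
  then show ?thesis
    using assms Gamma_real_pos[of "\<nu> + 1"] Gamma_real_pos[of "\<nu> + 1/2"]
    by (auto simp: angle_density_def)
qed

lemma integrable_angle_density_cos_power:
  assumes "\<nu> \<ge> 0"
  shows "integrable lborel (\<lambda>x. angle_density \<nu> x * cos x ^ p)"
proof (rule Bochner_Integration.integrable_bound)
  show "integrable lborel (\<lambda>x. Gamma (\<nu> + 1) / (sqrt pi * Gamma (\<nu> + 1/2)) * indicator {0..pi} x :: real)"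
    by (intro integrable_mult_right integrable_real_indicator) auto
  show "AE x in lborel. norm (angle_density \<nu> x * cos x ^ p)
      \<le> norm (Gamma (\<nu> + 1) / (sqrt pi * Gamma (\<nu> + 1/2)) * indicator {0..pi} x :: real)"
  proof (intro AE_I2)
    fix x
    have "norm (angle_density \<nu> x * cos x ^ p) = angle_density \<nu> x * \<bar>cos x\<bar> ^ p"
      using angle_density_nonneg[OF assms, of x] by (simp add: abs_mult power_abs)
    also have "\<dots> \<le> angle_density \<nu> x"
      using angle_density_nonneg[OF assms] by (intro mult_left_le power_le_one) auto
    finally show "norm (angle_density \<nu> x * cos x ^ p)
      \<le> norm (Gamma (\<nu> + 1) / (sqrt pi * Gamma (\<nu> + 1/2)) * indicator {0..pi} x :: real)"
      using angle_density_le[OF assms, of x] by (simp only: real_norm_def)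
  qed
qed simp

text \<open>
  Integrate the derivative of \<open>cos\<^sup>q x sin\<^bsup>2\<nu>+1\<^esup> x\<close>, which vanishes at both ends of \<open>[0, \<pi>]\<close>.
\<close>

lemma angle_density_cos_moment_rec:
  assumes "\<nu> \<ge> 0"
  shows "(real q + 2 * \<nu> + 1) * (LINT x|lborel. angle_density \<nu> x * cos x ^ Suc q)
    = real q * (LINT x|lborel. angle_density \<nu> x * cos x ^ (q - 1))"
proof -
  define C where "C = Gamma (\<nu> + 1) / (sqrt pi * Gamma (\<nu> + 1/2))"
  define D where "D x = angle_density \<nu> x * ((real q + 2 * \<nu> + 1) * cos x ^ Suc q - real q * cos x ^ (q - 1))" for x
  define G where "G x = C * (cos x ^ q * sin x powr (2 * \<nu> + 1))" for x
  have D_eq: "D = (\<lambda>x. (real q + 2 * \<nu> + 1) * (angle_density \<nu> x * cos x ^ Suc q)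
      - real q * (angle_density \<nu> x * cos x ^ (q - 1)))"
    by (auto simp: D_def algebra_simps)
  have int_D: "integrable lborel D"
    unfolding D_eq by (intro Bochner_Integration.integrable_diff integrable_mult_right
        integrable_angle_density_cos_power assms)
  \<comment> \<open>The interior form of the fundamental theorem: \<open>powr\<close> is
    differentiated only where \<open>sin x > 0\<close>, and at the endpoints continuity
    suffices.\<close>
  have "(D has_integral (G pi - G 0)) {0..pi}"
  proof (rule fundamental_theorem_of_calculus_interior)
    show "continuous_on {0..pi} G"
      unfolding G_def using assms by (intro continuous_intros continuous_on_powr') (auto intro: sin_ge_zero)
    fix x assume x: "x \<in> {0<..<pi}"
    then have s: "sin x > 0" by (auto intro: sin_gt_zero)
    have "(G has_real_derivative (C * (real q * cos x ^ (q - 1) * (- sin x) * sin x powr (2 * \<nu> + 1)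
        + ((2 * \<nu> + 1) * sin x powr (2 * \<nu>) * cos x) * cos x ^ q))) (at x)"
      unfolding G_def
      using s by (intro DERIV_cmult DERIV_mult) (auto intro!: derivative_eq_intros)
    also have "C * (real q * cos x ^ (q - 1) * (- sin x) * sin x powr (2 * \<nu> + 1)
        + ((2 * \<nu> + 1) * sin x powr (2 * \<nu>) * cos x) * cos x ^ q) = D x"
    proof -
      have 1: "sin x powr (2 * \<nu> + 1) = sin x powr (2 * \<nu>) * sin x"
        using s by (simp add: powr_add)
      have 2: "sin x * sin x = 1 - cos x * cos x"
        using sin_cos_squared_add3[of x] by linarith
      \<comment> \<open>For \<open>q = 0\<close> the truncated exponent \<open>q - 1\<close> does no
        harm because of the factor \<open>real q\<close>.\<close>
      have 3: "real q * cos x ^ (q - 1) * (cos x * cos x) = real q * cos x ^ Suc q"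
        by (cases q) auto
      have "real q * cos x ^ (q - 1) * (- sin x) * sin x powr (2 * \<nu> + 1)
        = - (sin x powr (2 * \<nu>)) * (real q * cos x ^ (q - 1) * (sin x * sin x))"
        by (simp add: 1)
      also have "real q * cos x ^ (q - 1) * (sin x * sin x)
          = real q * cos x ^ (q - 1) - real q * cos x ^ Suc q"
        unfolding 2 3[symmetric] by (simp add: algebra_simps)
      finally have *: "real q * cos x ^ (q - 1) * (- sin x) * sin x powr (2 * \<nu> + 1)
        = - (sin x powr (2 * \<nu>)) * (real q * cos x ^ (q - 1) - real q * cos x ^ Suc q)" .
      have "D x = C * sin x powr (2 * \<nu>) * ((real q + 2 * \<nu> + 1) * cos x ^ Suc q - real q * cos x ^ (q - 1))"
        using x by (simp add: D_def C_def angle_density_def)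
      then show ?thesis
        unfolding * by (simp add: algebra_simps)
    qed
    finally show "(G has_vector_derivative D x) (at x)"
      by (simp add: has_real_derivative_iff_has_vector_derivative)
  qed auto
  then have "integral {0..pi} D = 0"
    by (simp add: integral_unique G_def)
  moreover have "set_integrable lborel {0..pi} D"
    unfolding set_integrable_def by (intro integrable_mult_indicator int_D) auto
  ultimately have "(LINT x:{0..pi}|lborel. D x) = 0"
    by (simp add: set_borel_integral_eq_integral)
  also have "(LINT x:{0..pi}|lborel. D x) = (LINT x|lborel. D x)"
    unfolding set_lebesgue_integral_def
    by (intro Bochner_Integration.integral_cong) (auto simp: D_def angle_density_def split: split_indicator)
  finally show ?thesis
    unfolding D_eq using assms
    by (subst (asm) Bochner_Integration.integral_diff)
       (auto intro!: integrable_angle_density_cos_power integrable_mult_right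
         simp del: power_Suc)
qed

text \<open>At \<open>q = 0\<close> the recursion has right-hand side 0 and coefficient
  \<open>2 * \<nu> + 1 > 0\<close>; each further use raises the exponent by two.\<close>

lemma angle_density_cos_moment_odd:
  assumes "\<nu> \<ge> 0"
  shows "(LINT x|lborel. angle_density \<nu> x * cos x ^ (2 * k + 1)) = 0"
proof (induction k)
  case 0
  show ?case using angle_density_cos_moment_rec[OF assms, of 0] assms by simp
next
  case (Suc k)
  have "real (2 * k + 2) + 2 * \<nu> + 1 \<noteq> 0" using assms by linarith
  then show ?case using angle_density_cos_moment_rec[OF assms, of "2 * k + 2"] Suc by simp
qed

text \<open>The recursion determines the even moments up to the total mass. Assuming mass 1, which
  is later read off from the law of an angle, avoids evaluating a Beta integral.\<close>

lemma angle_density_cos_moment_even: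
  assumes "\<nu> \<ge> 0" and "(LINT x|lborel. angle_density \<nu> x) = 1"
  shows "(LINT x|lborel. angle_density \<nu> x * cos x ^ (2 * k))
    = Gamma (\<nu> + 1) * fact (2 * k) / (4 ^ k * fact k * Gamma (real k + \<nu> + 1))"
proof (induction k)
  case 0
  then show ?case using assms Gamma_real_pos[of "\<nu> + 1"] by (simp add: less_imp_neq[symmetric])
next
  case (Suc k)
  define m where "m = (LINT x|lborel. angle_density \<nu> x * cos x ^ (2 * Suc k))"
  define g where "g = Gamma (real k + \<nu> + 1)"
  have g: "g > 0" unfolding g_def using assms by (intro Gamma_real_pos) auto
  have G: "Gamma (real (Suc k) + \<nu> + 1) = (real k + \<nu> + 1) * g"
    using Gamma_plus1[of "real k + \<nu> + 1"] assms
    by (force simp: add_ac g_def elim!: nonpos_Ints_cases)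
  have "(2 * (real k + \<nu> + 1)) * m
      = (2 * real k + 1) * (Gamma (\<nu> + 1) * fact (2 * k) / (4 ^ k * fact k * g))"
  proof -
    have "real (2 * k + 1) + 2 * \<nu> + 1 = 2 * (real k + \<nu> + 1)" by simp
    with angle_density_cos_moment_rec[OF assms(1), of "2 * k + 1"] Suc show ?thesis
      by (simp add: m_def g_def add_ac)
  qed
  moreover have "2 * (real k + \<nu> + 1) \<noteq> 0" using assms by simp
  ultimately have "m = (2 * real k + 1) * (Gamma (\<nu> + 1) * fact (2 * k) / (4 ^ k * fact k * g))
     / (2 * (real k + \<nu> + 1))"
    by (metis nonzero_mult_div_cancel_left)
  also have "\<dots> = Gamma (\<nu> + 1) * fact (2 * Suc k) / (4 ^ Suc k * fact (Suc k) * ((real k + \<nu> + 1) * g))"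
    using assms g by (simp add: divide_simps) (simp add: algebra_simps)
  finally show ?case by (simp only: m_def G)
qed

text \<open>Expand the exponential and integrate termwise. Odd moments vanish; in the even terms
  \<open>fact (2 * k)\<close> cancels and \<open>4 ^ k\<close> turns \<open>z\<close> into
  \<open>z / 2\<close>, which leaves the Bessel series.\<close>

lemma (in prob_space) char_cos_angle:
  assumes "\<nu> \<ge> 0" and \<Theta>: "distributed M lborel \<Theta> (\<lambda>x. ennreal (angle_density \<nu> x))"
  shows "expectation (\<lambda>\<omega>. exp (\<i> * complex_of_real (z * cos (\<Theta> \<omega>))))
    = complex_of_real (2 powr \<nu> * Gamma (\<nu> + 1) * bessel_J_quot \<nu> z)"
proof -
  have [measurable]: "\<Theta> \<in> borel_measurable M"
    using distributed_measurable[OF \<Theta>] by simp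
  have moment: "(LINT x|lborel. angle_density \<nu> x * cos x ^ p) = expectation (\<lambda>\<omega>. cos (\<Theta> \<omega>) ^ p)" for p
    by (rule distributed_integral[OF \<Theta>]) (use assms angle_density_nonneg in auto)
  \<comment> \<open>The moment of order 0 is the total probability, so the density is normalized
    because it is the law of \<open>\<Theta>\<close>.\<close>
  have mass: "(LINT x|lborel. angle_density \<nu> x) = 1"
    using moment[of 0] by (simp add: prob_space)
  define f where "f p \<omega> = (\<i> * complex_of_real z) ^ p /\<^sub>R fact p * complex_of_real (cos (\<Theta> \<omega>) ^ p)" for p \<omega>
  have f_eq: "f p \<omega> = (\<i> * complex_of_real (z * cos (\<Theta> \<omega>))) ^ p /\<^sub>R fact p" for p \<omega>
    by (simp add: f_def power_mult_distrib)
  have norm_f: "norm (f p \<omega>) \<le> \<bar>z\<bar> ^ p /\<^sub>R fact p" for p \<omega>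
  proof -
    have "\<bar>cos (\<Theta> \<omega>)\<bar> ^ p \<le> 1" by (intro power_le_one) auto
    then have "\<bar>z\<bar> ^ p * \<bar>cos (\<Theta> \<omega>)\<bar> ^ p \<le> \<bar>z\<bar> ^ p * 1" by (intro mult_left_mono) auto
    then show ?thesis by (simp add: f_def norm_mult norm_power power_abs divide_simps)
  qed
  have summable_bound: "summable (\<lambda>p. \<bar>z\<bar> ^ p /\<^sub>R fact p)"
    by (rule summable_exp_generic)
  have int_f: "integrable M (f p)" for p
    by (rule integrable_const_bound[where B = "\<bar>z\<bar> ^ p /\<^sub>R fact p"])
       (use norm_f in \<open>auto simp: f_def[abs_def]\<close>)
  \<comment> \<open>Sum and expectation may be exchanged because the norms are dominated by the
    exponential series at the absolute value of \<open>z\<close>.\<close>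
  have "(\<lambda>p. expectation (f p)) sums expectation (\<lambda>\<omega>. \<Sum>p. f p \<omega>)"
  proof (rule sums_integral[OF int_f])
    show "AE \<omega> in M. summable (\<lambda>p. norm (f p \<omega>))"
      by (intro AE_I2 summable_comparison_test'[OF summable_bound]) (use norm_f in auto)
    show "summable (\<lambda>p. expectation (\<lambda>\<omega>. norm (f p \<omega>)))"
    proof (rule summable_comparison_test'[OF summable_bound])
      fix p
      have "expectation (\<lambda>\<omega>. norm (f p \<omega>)) \<le> expectation (\<lambda>\<omega>. \<bar>z\<bar> ^ p /\<^sub>R fact p)"
        by (intro integral_mono integrable_norm int_f norm_f) auto
      then show "norm (expectation (\<lambda>\<omega>. norm (f p \<omega>))) \<le> \<bar>z\<bar> ^ p /\<^sub>R fact p"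
        by (simp add: prob_space)
    qed
  qed
  moreover have "(\<Sum>p. f p \<omega>) = exp (\<i> * complex_of_real (z * cos (\<Theta> \<omega>)))" for \<omega>
    by (simp add: f_eq exp_def)
  ultimately have sums: "(\<lambda>p. expectation (f p)) sums expectation (\<lambda>\<omega>. exp (\<i> * complex_of_real (z * cos (\<Theta> \<omega>))))"
    by simp
  have Ef: "expectation (f p) = (\<i> * complex_of_real z) ^ p /\<^sub>R fact p *
      complex_of_real (LINT x|lborel. angle_density \<nu> x * cos x ^ p)" for p
    unfolding f_def by (simp only: integral_mult_right_zero integral_complex_of_real moment)
  have odd: "expectation (f p) = 0" if "p \<notin> range (\<lambda>k. 2 * k)" for p
  proof -
    from that have "odd p" by (auto elim!: evenE)
    then obtain k where "p = 2 * k + 1" by (auto elim!: oddE)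
    then show ?thesis unfolding Ef using angle_density_cos_moment_odd[OF assms(1), of k] by simp
  qed
  have "strict_mono (\<lambda>k::nat. 2 * k)" by (auto simp: strict_mono_def)
  from sums_mono_reindex[of "\<lambda>k. 2 * k" "\<lambda>p. expectation (f p)", OF this odd] sums
  have "(\<lambda>k. expectation (f (2 * k))) sums expectation (\<lambda>\<omega>. exp (\<i> * complex_of_real (z * cos (\<Theta> \<omega>))))"
    by blast
  moreover have "expectation (f (2 * k)) = complex_of_real (Gamma (\<nu> + 1) *
     ((-1) ^ k * (z / 2) ^ (2 * k) / (fact k * Gamma (real k + \<nu> + 1))))" for k
  proof -
    have g: "Gamma (real k + \<nu> + 1) > 0" using assms by (intro Gamma_real_pos) auto
    have "(\<i> * complex_of_real z) ^ (2 * k) = complex_of_real ((-1) ^ k * z ^ (2 * k))"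
      by (simp add: power_mult_distrib power_mult flip: power_minus)
    then have "expectation (f (2 * k)) = complex_of_real ((-1) ^ k * z ^ (2 * k) / fact (2 * k) *
      (Gamma (\<nu> + 1) * fact (2 * k) / (4 ^ k * fact k * Gamma (real k + \<nu> + 1))))"
      unfolding Ef angle_density_cos_moment_even[OF assms(1) mass]
      by (simp add: scaleR_conv_of_real divide_inverse mult_ac)
    also have "(-1) ^ k * z ^ (2 * k) / fact (2 * k) *
      (Gamma (\<nu> + 1) * fact (2 * k) / (4 ^ k * fact k * Gamma (real k + \<nu> + 1)))
      = Gamma (\<nu> + 1) * ((-1) ^ k * (z / 2) ^ (2 * k) / (fact k * Gamma (real k + \<nu> + 1)))"
    proof -
      have "(z / 2) ^ (2 * k) = z ^ (2 * k) / 4 ^ k" by (simp add: power_divide power_mult)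
      with g show ?thesis by (simp add: mult_ac)
    qed
    finally show ?thesis .
  qed
  moreover have "(\<lambda>k. complex_of_real (Gamma (\<nu> + 1) *
     ((-1) ^ k * (z / 2) ^ (2 * k) / (fact k * Gamma (real k + \<nu> + 1))))) sums
     complex_of_real (Gamma (\<nu> + 1) * (\<Sum>k. (-1) ^ k * (z / 2) ^ (2 * k) / (fact k * Gamma (real k + \<nu> + 1))))"
    by (intro sums_of_real sums_mult summable_sums bessel_J_quot_summable assms)
  ultimately have "expectation (\<lambda>\<omega>. exp (\<i> * complex_of_real (z * cos (\<Theta> \<omega>)))) =
     complex_of_real (Gamma (\<nu> + 1) * (\<Sum>k. (-1) ^ k * (z / 2) ^ (2 * k) / (fact k * Gamma (real k + \<nu> + 1))))"
    by (simp add: sums_iff)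
  then show ?thesis by (simp add: bessel_J_quot_def powr_minus)
qed

section \<open>Ordered integrals and independent uniform points\<close>

lemma pred_sorted_wrt_PiM:
  assumes "set is \<subseteq> I" and [measurable_cong]: "sets U = sets (borel :: real measure)"
  shows "Measurable.pred (Pi\<^sub>M I (\<lambda>_. U)) (\<lambda>x. sorted_wrt (<) (map x is))"
  using assms(1)
proof (induction "is")
  case (Cons k ks)
  then have [measurable]: "(\<lambda>x. x l) \<in> borel_measurable (Pi\<^sub>M I (\<lambda>_. U))" if "l \<in> set (k # ks)" for l
    using that by auto
  from Cons show ?case by simp
qed simp

lemma sorted_wrt_map_upt_iff:
  fixes x :: "nat \<Rightarrow> real"
  shows "sorted_wrt (<) (map x [1..<Suc n]) \<longleftrightarrow> strict_mono_on {1..n} x"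
proof
  assume sorted: "sorted_wrt (<) (map x [1..<Suc n])"
  show "strict_mono_on {1..n} x"
  proof (rule strict_mono_onI)
    fix j k assume "j \<in> {1..n}" "k \<in> {1..n}" "j < k"
    then show "x j < x k"
      using sorted_wrt_nth_less[OF sorted, of "j - 1" "k - 1"] by (simp del: upt_Suc)
  qed
qed (auto simp: sorted_wrt_iff_nth_less strict_mono_on_def simp del: upt_Suc)

text \<open>
  The uniform law makes every bounded measurable function integrable, whence the factor
  \<open>t\<^sup>k\<close>. The order is strict, so that it can be compared with the cells of a grid.
\<close>

lemma ordered_integral_eq_PiM:
  fixes F :: "real list \<Rightarrow> real" and t a :: real
  defines "U \<equiv> uniform_measure lborel {0<..t}"
  assumes "t > 0" and "distinct is" and "0 \<le> a"
    and "(\<lambda>x. F (map x is)) \<in> borel_measurable (Pi\<^sub>M (set is) (\<lambda>_. U))"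
    and "\<And>xs. \<bar>F xs\<bar> \<le> B"
  shows "ordered_integral (length is) a t F = t ^ length is *
    (LINT x|Pi\<^sub>M (set is) (\<lambda>_. U). of_bool (sorted_wrt (<) (a # map x is)) * F (map x is))"
  using assms(3-6)
proof (induction "is" arbitrary: a F)
  case Nil
  then show ?case
    by (simp add: PiM_empty lebesgue_integral_count_space_finite)
next
  case (Cons i js)
  have t: "emeasure lborel {0<..t} = ennreal t" using \<open>t > 0\<close> by simp
  interpret U: prob_space U
    unfolding U_def using \<open>t > 0\<close> by (intro prob_space_uniform_measure) (auto simp: t)
  interpret product_prob_space "\<lambda>_::'a. U" UNIV by unfold_locales
  interpret J: prob_space "Pi\<^sub>M (set js) (\<lambda>_. U)" by (intro prob_space_PiM U.prob_space_axioms)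
  interpret I: prob_space "Pi\<^sub>M (insert i (set js)) (\<lambda>_. U)" by (intro prob_space_PiM U.prob_space_axioms)
  have [measurable_cong, simp]: "sets U = sets borel" by (simp add: U_def)
  have [simp]: "space U = UNIV" by (simp add: U_def)
  have B: "B \<ge> 0" using Cons.prems(4)[of "[]"] by linarith
  from Cons.prems have i: "i \<notin> set js" and js: "distinct js" by auto
  have [measurable]: "(\<lambda>x. F (x i # map x js)) \<in> borel_measurable (Pi\<^sub>M (insert i (set js)) (\<lambda>_. U))"
    using Cons.prems(3) by simp
  define H where "H b y = of_bool (sorted_wrt (<) (b # map y js)) * F (b # map y js)" for b y
  \<comment> \<open>By transitivity the order of the whole list splits into \<open>a < x i\<close>
    and the order of the list starting with \<open>x i\<close>. So \<open>x i\<close> becomes the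
    lower limit of the remaining integral, as in the recursion of
    \<open>ordered_integral\<close>.\<close>
  have cons_eq: "of_bool (sorted_wrt (<) (a # map x (i # js))) * F (map x (i # js))
      = of_bool (a < x i) * H (x i) x" for x
    by (auto simp: H_def intro: less_trans)
  have meas_H [measurable]: "(\<lambda>x. H (x i) x) \<in> borel_measurable (Pi\<^sub>M (insert i (set js)) (\<lambda>_. U))"
    using pred_sorted_wrt_PiM[of "i # js" "insert i (set js)" U] unfolding H_def by simp
  have H_bound: "\<bar>H b y\<bar> \<le> B" for b y
    unfolding H_def using Cons.prems(4)[of "b # map y js"] B by (auto simp: abs_mult)
  have int_H: "integrable (Pi\<^sub>M (insert i (set js)) (\<lambda>_. U)) (\<lambda>x. of_bool (a < x i) * H (x i) x)"
    by (rule I.integrable_const_bound[where B = B]) (use H_bound B in \<open>auto simp: abs_mult\<close>)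
  have merge_i: "merge {i} (set js) (x, y) i = x i" for x y
    by (simp add: merge_def)
  \<comment> \<open>Since \<open>i\<close> is not in \<open>js\<close>, \<open>H b\<close> ignores
    coordinate \<open>i\<close>; the other coordinates can be integrated first with \<open>b\<close>
    held fixed.\<close>
  have H_merge: "H b (merge {i} (set js) (x, y)) = H b y" for b x y
  proof -
    have "map (merge {i} (set js) (x, y)) js = map y js"
      using i by (intro map_cong) (auto simp: merge_def)
    then show ?thesis by (simp only: H_def)
  qed
  define h where "h b = (LINT y|Pi\<^sub>M (set js) (\<lambda>_. U). H b y)" for b
  \<comment> \<open>Inserting \<open>b\<close> as coordinate \<open>i\<close> carries measurability
    on the product over \<open>insert i (set js)\<close> over to joint measurability in
    \<open>(b, y)\<close>.\<close>
  have upd: "(\<lambda>(b, y). y(i := b)) \<in> measurable (borel \<Otimes>\<^sub>M Pi\<^sub>M (set js) (\<lambda>_. U)) (Pi\<^sub>M (insert i (set js)) (\<lambda>_. U))"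
    by measurable
  have H_upd: "H b (y(i := b)) = H b y" for b y
  proof -
    have "map (y(i := b)) js = map y js" using i by (intro map_cong) auto
    then show ?thesis by (simp only: H_def fun_upd_same)
  qed
  have [measurable]: "(\<lambda>(b, y). H b y) \<in> borel_measurable (borel \<Otimes>\<^sub>M Pi\<^sub>M (set js) (\<lambda>_. U))"
    using measurable_compose[OF upd meas_H] by (simp add: case_prod_beta H_upd)
  have meas_h [measurable]: "h \<in> borel_measurable borel"
    unfolding h_def by measurable
  have "(LINT x|Pi\<^sub>M (insert i (set js)) (\<lambda>_. U). of_bool (a < x i) * H (x i) x)
      = (LINT x|Pi\<^sub>M {i} (\<lambda>_. U). LINT y|Pi\<^sub>M (set js) (\<lambda>_. U). of_bool (a < x i) * H (x i) y)"
    using product_integral_fold[of "{i}" "set js" "\<lambda>x. of_bool (a < x i) * H (x i) x"] i int_H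
    by (simp add: H_merge merge_i)
  also have "\<dots> = (LINT b|U. of_bool (a < b) * h b)"
    by (subst product_integral_singleton[symmetric]) (simp_all add: h_def)
  also have "\<dots> = (LINT b|lborel. (indicator {0<..t} b / t) *\<^sub>R (of_bool (a < b) * h b))"
  proof -
    have "U = density lborel (\<lambda>b. ennreal (indicator {0<..t} b / t))"
      unfolding U_def uniform_measure_def using \<open>t > 0\<close>
      by (intro density_cong) (auto split: split_indicator simp: divide_ennreal ennreal_1[symmetric] simp del: ennreal_1)
    then show ?thesis
      using \<open>t > 0\<close> by (simp add: integral_density)
  qed
  finally have "(LINT x|Pi\<^sub>M (insert i (set js)) (\<lambda>_. U). of_bool (a < x i) * H (x i) x)
      = (LINT b|lborel. (indicator {0<..t} b / t) *\<^sub>R (of_bool (a < b) * h b))" .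
  also have "t ^ length (i # js) * \<dots>
      = (LINT b|lborel. t ^ length (i # js) * ((indicator {0<..t} b / t) *\<^sub>R (of_bool (a < b) * h b)))"
    by simp
  \<comment> \<open>One factor \<open>t\<close> cancels against the uniform density. The strict
    constraint and \<open>{a..t}\<close> differ only at the null point \<open>a\<close>, and
    \<open>0 \<le> a\<close> keeps the range inside the support.\<close>
  also have "\<dots> = (LINT b|lborel. indicator {a..t} b *\<^sub>R (t ^ length js * h b))"
  proof (rule integral_cong_AE)
    show "AE b in lborel. t ^ length (i # js) * ((indicator {0<..t} b / t) *\<^sub>R (of_bool (a < b) * h b))
        = indicator {a..t} b *\<^sub>R (t ^ length js * h b)"
      using AE_lborel_singleton[of a]
      by eventually_elim (use \<open>t > 0\<close> Cons.prems(2) in \<open>auto split: split_indicator\<close>)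
  qed auto
  also have "\<dots> = ordered_integral (length (i # js)) a t F"
  proof -
    have "ordered_integral (length js) b t (\<lambda>xs. F (b # xs)) = t ^ length js * h b" if "b \<in> {a..t}" for b
      unfolding h_def H_def
    proof (rule Cons.IH[OF js])
      show "0 \<le> b" using that Cons.prems(2) by auto
      show "\<bar>F (b # xs)\<bar> \<le> B" for xs by (rule Cons.prems(4))
      have [measurable]: "(\<lambda>y. y(i := b)) \<in> measurable (Pi\<^sub>M (set js) (\<lambda>_. U)) (Pi\<^sub>M (insert i (set js)) (\<lambda>_. U))"
        by measurable
      have "(\<lambda>y. F ((y(i := b)) i # map (y(i := b)) js)) \<in> borel_measurable (Pi\<^sub>M (set js) (\<lambda>_. U))"
        by measurable
      also have "(\<lambda>y. F ((y(i := b)) i # map (y(i := b)) js)) = (\<lambda>y. F (b # map y js))"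
      proof
        fix y
        have "map (y(i := b)) js = map y js" using i by (intro map_cong) auto
        then show "F ((y(i := b)) i # map (y(i := b)) js) = F (b # map y js)" by (simp only: fun_upd_same)
      qed
      finally show "(\<lambda>y. F (b # map y js)) \<in> borel_measurable (Pi\<^sub>M (set js) (\<lambda>_. U))" .
    qed
    then show ?thesis
      by (auto simp: set_lebesgue_integral_def intro!: Bochner_Integration.integral_cong split: split_indicator)
  qed
  finally show ?case by (simp only: cons_eq list.set)
qed

section \<open>Grid approximation\<close>

text \<open>Strict monotonicity puts at most one event into a cell. Extensionality makes each choice
  of cells a single function, so sums over this set count it once.\<close>

definition grid_maps :: "nat \<Rightarrow> nat \<Rightarrow> (nat \<Rightarrow> nat) set" where
  "grid_maps n m = {i \<in> {1..n} \<rightarrow>\<^sub>E {..<m}. strict_mono_on {1..n} i}"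

text \<open>Cells are open on the left and closed on the right, so that an event time lies in a cell
  exactly when the counting process passes its level between the two ends.\<close>

definition in_cells :: "real \<Rightarrow> nat \<Rightarrow> nat \<Rightarrow> (nat \<Rightarrow> nat) \<Rightarrow> (nat \<Rightarrow> real) \<Rightarrow> bool" where
  "in_cells t m n i x \<longleftrightarrow>
     (\<forall>j\<in>{1..n}. real (i j) * (t / real m) < x j \<and> x j \<le> real (Suc (i j)) * (t / real m))"

definition corner :: "real \<Rightarrow> nat \<Rightarrow> (nat \<Rightarrow> nat) \<Rightarrow> nat \<Rightarrow> real" where
  "corner t m i j = real (Suc (i j)) * (t / real m)"

text \<open>At most one summand is nonzero. This is therefore a step function, equal to 0 when two
  of the points share a cell or are out of order.\<close>

definition grid_approx ::
  "real \<Rightarrow> nat \<Rightarrow> nat \<Rightarrow> ((nat \<Rightarrow> real) \<Rightarrow> 'b::real_normed_vector) \<Rightarrow> (nat \<Rightarrow> real) \<Rightarrow> 'b" where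
  "grid_approx t m n \<psi> x =
     (\<Sum>i\<in>grid_maps n m. of_bool (in_cells t m n i x) *\<^sub>R \<psi> (corner t m i))"

lemma finite_grid_maps: "finite (grid_maps n m)"
  unfolding grid_maps_def by (rule finite_subset[of _ "{1..n} \<rightarrow>\<^sub>E {..<m}"]) (auto intro: finite_PiE)

lemma in_cells_unique:
  assumes "i \<in> grid_maps n m" "i' \<in> grid_maps n m" "in_cells t m n i x" "in_cells t m n i' x"
  shows "i = i'"
proof
  fix j
  show "i j = i' j"
  proof (cases "j \<in> {1..n}")
    case True
    define d where "d = t / real m"
    from assms True have *: "real (i j) * d < x j" "x j \<le> real (Suc (i j)) * d"
      "real (i' j) * d < x j" "x j \<le> real (Suc (i' j)) * d"
      by (auto simp: in_cells_def d_def)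
    \<comment> \<open>A cell containing a point has positive length. Two cells sharing a point then
      have indices less than 1 apart.\<close>
    from *(1,2) have "d > 0" by (simp add: distrib_right)
    moreover from * have "real (i j) * d < real (Suc (i' j)) * d" "real (i' j) * d < real (Suc (i j)) * d"
      by linarith+
    ultimately show ?thesis by simp
  qed (use assms in \<open>auto simp: grid_maps_def PiE_def extensional_def\<close>)
qed

lemma grid_approx_in_cells:
  assumes "i \<in> grid_maps n m" "in_cells t m n i x"
  shows "grid_approx t m n \<psi> x = \<psi> (corner t m i)"
proof -
  have "grid_approx t m n \<psi> x = (\<Sum>k\<in>grid_maps n m. if k = i then \<psi> (corner t m i) else 0)"
    unfolding grid_approx_def
    by (intro sum.cong) (use assms in_cells_unique in \<open>auto\<close>)
  then show ?thesis using assms by (simp add: finite_grid_maps)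
qed

lemma grid_approx_eq_0:
  assumes "\<And>i. i \<in> grid_maps n m \<Longrightarrow> \<not> in_cells t m n i x"
  shows "grid_approx t m n \<psi> x = 0"
  unfolding grid_approx_def by (intro sum.neutral) (use assms in auto)

lemma norm_grid_approx_le:
  assumes "\<And>y. norm (\<psi> y) \<le> B"
  shows "norm (grid_approx t m n \<psi> x) \<le> B"
proof (cases "\<exists>i\<in>grid_maps n m. in_cells t m n i x")
  case True
  then show ?thesis using assms grid_approx_in_cells by metis
next
  case False
  then have "grid_approx t m n \<psi> x = 0" by (intro grid_approx_eq_0) auto
  then show ?thesis using order_trans[OF norm_ge_zero assms] by simp
qed

section \<open>Pointwise convergence of the grid approximation\<close>

lemma in_cells_imp_strict_mono_on:
  assumes "t \<ge> 0" "i \<in> grid_maps n m" "in_cells t m n i x"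
  shows "strict_mono_on {1..n} x"
proof (rule strict_mono_onI)
  fix j k assume jk: "j \<in> {1..n}" "k \<in> {1..n}" "j < k"
  with assms have "i j < i k" by (auto simp: grid_maps_def strict_mono_on_def)
  have "x j \<le> real (Suc (i j)) * (t / real m)" using jk assms by (auto simp: in_cells_def)
  also have "\<dots> \<le> real (i k) * (t / real m)"
    using \<open>i j < i k\<close> assms by (intro mult_right_mono) auto
  also have "\<dots> < x k" using jk assms by (auto simp: in_cells_def)
  finally show "x j < x k" .
qed

lemma cell_index:
  fixes t x :: real
  assumes "t > 0" "m > 0" "0 < x" "x \<le> t"
  obtains l where "l < m" "real l * (t / real m) < x" "x \<le> real (Suc l) * (t / real m)"
proof
  \<comment> \<open>The ceiling minus one, and not the floor: a grid point belongs to the cell on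
    its left.\<close>
  define l where "l = nat (\<lceil>x / (t / real m)\<rceil> - 1)"
  have d: "t / real m > 0" using assms by simp
  have pos: "x / (t / real m) > 0" using d assms by simp
  then have "real l = real_of_int \<lceil>x / (t / real m)\<rceil> - 1"
    unfolding l_def by (subst of_nat_nat) auto
  then have l: "real l < x / (t / real m)" "x / (t / real m) \<le> real l + 1" by linarith+
  from l(1) show "real l * (t / real m) < x" by (simp only: pos_less_divide_eq[OF d])
  from l(2) show "x \<le> real (Suc l) * (t / real m)" by (simp only: pos_divide_le_eq[OF d] of_nat_Suc add.commute)
  have "x / (t / real m) \<le> real m" using assms by (simp add: divide_simps)
  with l(1) show "l < m" by linarith
qed

text \<open>If the points are not strictly increasing, the approximation is 0 for every
  \<open>m\<close>. Otherwise a fine enough grid separates them, and the corners are within one mesh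
  width of the points, so sequential continuity of \<open>\<psi>\<close> at \<open>x\<close>
  finishes.\<close>

lemma grid_approx_tendsto:
  fixes \<psi> :: "(nat \<Rightarrow> real) \<Rightarrow> 'b::real_normed_vector"
  assumes "t > 0" and x: "\<And>j. j \<in> {1..n} \<Longrightarrow> 0 < x j \<and> x j \<le> t"
    and cont: "\<And>y. (\<And>j. j \<in> {1..n} \<Longrightarrow> (\<lambda>m. y m j) \<longlonglongrightarrow> x j) \<Longrightarrow> (\<lambda>m. \<psi> (y m)) \<longlonglongrightarrow> \<psi> x"
  shows "(\<lambda>m. grid_approx t m n \<psi> x) \<longlonglongrightarrow> of_bool (strict_mono_on {1..n} x) *\<^sub>R \<psi> x"
proof (cases "strict_mono_on {1..n} x")
  case False
  have "grid_approx t m n \<psi> x = 0" for m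
    using False in_cells_imp_strict_mono_on \<open>t > 0\<close> by (intro grid_approx_eq_0) (meson less_imp_le)
  with False show ?thesis by simp
next
  case strict: True
  have "\<exists>l. \<forall>j\<in>{1..n}. m > 0 \<longrightarrow> l j < m \<and> real (l j) * (t / real m) < x j \<and> x j \<le> real (Suc (l j)) * (t / real m)" for m
    using cell_index[OF \<open>t > 0\<close>, of m] x by (intro bchoice ballI) metis
  then obtain l where l: "\<And>m j. m > 0 \<Longrightarrow> j \<in> {1..n} \<Longrightarrow>
      l m j < m \<and> real (l m j) * (t / real m) < x j \<and> x j \<le> real (Suc (l m j)) * (t / real m)"
    by metis
  define i where "i m = restrict (l m) {1..n}" for m
  have mesh: "(\<lambda>m. t / real m) \<longlonglongrightarrow> 0" by (rule lim_const_over_n)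
  have cells: "in_cells t m n (i m) x" if "m > 0" for m
    using l[OF that] by (auto simp: in_cells_def i_def)
  \<comment> \<open>Once the mesh is below the gap \<open>x k - x j\<close>, the two points have
    different cells in the right order; finitely many pairs share a common threshold.\<close>
  have "\<forall>\<^sub>F m in sequentially. \<forall>j\<in>{1..n}. \<forall>k\<in>{1..n}. j < k \<longrightarrow> l m j < l m k"
  proof (intro eventually_ball_finite ballI finite_atLeastAtMost)
    fix j k assume jk: "j \<in> {1..n}" "k \<in> {1..n}"
    show "\<forall>\<^sub>F m in sequentially. j < k \<longrightarrow> l m j < l m k"
    proof (cases "j < k")
      case True
      then have "x k - x j > 0" using strict jk by (auto simp: strict_mono_on_def)
      with mesh have "\<forall>\<^sub>F m in sequentially. t / real m < x k - x j"
        by (rule order_tendstoD)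
      with eventually_gt_at_top[of 0] show ?thesis
      proof eventually_elim
        case (elim m)
        have "real (Suc (l m j)) * (t / real m) = real (l m j) * (t / real m) + t / real m"
          by (simp add: distrib_right add.commute add_divide_distrib)
        also have "\<dots> < real (Suc (l m k)) * (t / real m)"
          using l[OF elim(1) jk(1)] l[OF elim(1) jk(2)] elim(2) by linarith
        finally have "real (Suc (l m j)) < real (Suc (l m k))"
          by (rule mult_right_less_imp_less) (use \<open>t > 0\<close> in auto)
        then show ?case by simp
      qed
    qed auto
  qed
  with eventually_gt_at_top[of 0]
  have "\<forall>\<^sub>F m in sequentially. grid_approx t m n \<psi> x = \<psi> (corner t m (i m))"
  proof eventually_elim
    case (elim m)
    have "i m \<in> grid_maps n m"
      using l[OF elim(1)] elim(2) by (auto simp: grid_maps_def i_def strict_mono_on_def)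
    then show ?case using cells elim by (intro grid_approx_in_cells)
  qed
  moreover have "(\<lambda>m. \<psi> (corner t m (i m))) \<longlonglongrightarrow> \<psi> x"
  proof (rule cont)
    fix j assume j: "j \<in> {1..n}"
    show "(\<lambda>m. corner t m (i m) j) \<longlonglongrightarrow> x j"
    proof (rule real_tendsto_sandwich)
      show "\<forall>\<^sub>F m in sequentially. x j \<le> corner t m (i m) j"
        using eventually_gt_at_top[of 0]
        by eventually_elim (use l j in \<open>auto simp: corner_def i_def\<close>)
      show "\<forall>\<^sub>F m in sequentially. corner t m (i m) j \<le> x j + t / real m"
        using eventually_gt_at_top[of 0]
      proof eventually_elim
        case (elim m)
        have "corner t m (i m) j = real (l m j) * (t / real m) + t / real m"
          using j by (simp add: corner_def i_def distrib_right add.commute add_divide_distrib)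
        with l[OF elim j] show ?case by linarith
      qed
      show "(\<lambda>m. x j + t / real m) \<longlonglongrightarrow> x j"
        using tendsto_add[OF tendsto_const mesh, of "x j"] by simp
    qed auto
  qed
  ultimately show ?thesis
    using strict by (simp add: tendsto_cong)
qed

text \<open>Here \<open>f k\<close> stands for the number of events up to the \<open>k\<close>-th
  grid point. Both sides say that \<open>f\<close> agrees up to \<open>m\<close> with
  \<open>c\<close>, the number of prescribed cells below a grid point.\<close>

lemma increments_iff:
  fixes f :: "nat \<Rightarrow> nat"
  assumes i: "i \<in> grid_maps n m" and "mono f" and "f 0 = 0"
  shows "(\<forall>k<m. f (Suc k) - f k = of_bool (k \<in> i ` {1..n})) \<longleftrightarrow>
    f m = n \<and> (\<forall>j\<in>{1..n}. f (i j) < j \<and> j \<le> f (Suc (i j)))"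
proof -
  have lt: "i j < m" if "j \<in> {1..n}" for j using i that by (auto simp: grid_maps_def)
  have smono: "i j < i k \<longleftrightarrow> j < k" if "j \<in> {1..n}" "k \<in> {1..n}" for j k
    using i that strict_mono_on_less[of "{1..n}" i j k] by (simp add: grid_maps_def)
  have inj: "inj_on i {1..n}"
    using i unfolding grid_maps_def by (intro strict_mono_on_imp_inj_on) simp
  define c where "c k = card {j\<in>{1..n}. i j < k}" for k
  have c_Suc: "c (Suc k) = c k + of_bool (k \<in> i ` {1..n})" for k
  proof (cases "k \<in> i ` {1..n}")
    case True
    then obtain j where j: "j \<in> {1..n}" "k = i j" by auto
    have "{j\<in>{1..n}. i j < Suc k} = insert j {j\<in>{1..n}. i j < k}"
      unfolding j(2) less_Suc_eq using j(1) inj_onD[OF inj] by blast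
    then show ?thesis using True by (simp add: c_def \<open>k = i j\<close>)
  next
    case False
    then have "{j\<in>{1..n}. i j < Suc k} = {j\<in>{1..n}. i j < k}"
      by (auto simp: less_Suc_eq)
    then show ?thesis using False by (simp add: c_def)
  qed
  have c_0: "c 0 = 0" by (simp add: c_def)
  have c_m: "c m = n"
  proof -
    have "{j\<in>{1..n}. i j < m} = {1..n}" using lt by auto
    then show ?thesis by (simp add: c_def)
  qed
  have c_i: "c (i j) = j - 1" if "j \<in> {1..n}" for j
  proof -
    have "{k\<in>{1..n}. i k < i j} = {1..<j}" using that smono by auto
    then show ?thesis by (simp add: c_def)
  qed
  show ?thesis
  proof (intro iffI conjI ballI)
    assume inc: "\<forall>k<m. f (Suc k) - f k = of_bool (k \<in> i ` {1..n})"
    have fc: "f k = c k" if "k \<le> m" for k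
      using that
    proof (induction k)
      case (Suc k)
      \<comment> \<open>Monotonicity makes the truncated difference the true increment.\<close>
      have "f k \<le> f (Suc k)" using \<open>mono f\<close> by (simp add: mono_def)
      with inc Suc have "f (Suc k) = f k + of_bool (k \<in> i ` {1..n})" by (metis Suc_le_lessD le_add_diff_inverse)
      then show ?case using Suc c_Suc by simp
    qed (simp add: c_0 assms)
    show "f m = n" using fc c_m by simp
    fix j assume j: "j \<in> {1..n}"
    show "f (i j) < j" using fc[of "i j"] lt[OF j] c_i[OF j] j by auto
    show "j \<le> f (Suc (i j))"
      using fc[of "Suc (i j)"] lt[OF j] c_i[OF j] j by (auto simp: c_Suc)
  next
    assume *: "f m = n \<and> (\<forall>j\<in>{1..n}. f (i j) < j \<and> j \<le> f (Suc (i j)))"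
    have fc: "f k = c k" if "k \<le> m" for k
    proof -
      have "f k \<le> n" using * that \<open>mono f\<close> by (metis monoD)
      \<comment> \<open>Count the levels reached by \<open>f k\<close>. The hypothesis at the two
        ends of cell \<open>i j\<close> shows that level \<open>j\<close> is reached exactly when
        \<open>i j < k\<close>.\<close>
      then have "f k = card {j\<in>{1..n}. j \<le> f k}"
      proof -
        have "{j\<in>{1..n}. j \<le> f k} = {1..f k}" using \<open>f k \<le> n\<close> by auto
        then show ?thesis by simp
      qed
      also have "{j\<in>{1..n}. j \<le> f k} = {j\<in>{1..n}. i j < k}"
      proof (intro Collect_cong conj_cong refl)
        fix j assume j: "j \<in> {1..n}"
        show "j \<le> f k \<longleftrightarrow> i j < k"
        proof
          assume "i j < k"
          then have "f (Suc (i j)) \<le> f k" using \<open>mono f\<close> by (auto simp: mono_def)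
          with * j show "j \<le> f k" by (meson le_trans)
        next
          assume "j \<le> f k"
          show "i j < k"
          proof (rule ccontr)
            assume "\<not> i j < k"
            then have "f k \<le> f (i j)" using \<open>mono f\<close> by (auto simp: mono_def)
            with * j \<open>j \<le> f k\<close> show False by (meson le_trans not_le)
          qed
        qed
      qed
      finally show ?thesis by (simp add: c_def)
    qed
    show "\<forall>k<m. f (Suc k) - f k = of_bool (k \<in> i ` {1..n})"
      using fc c_Suc by auto
  qed
qed

text \<open>The volume of a simplex, needed at \<alpha> = 0 to recognise the Poisson weight of
  \<open>N t = n\<close>.\<close>

lemma ordered_integral_one:
  assumes "a \<le> t"
  shows "ordered_integral n a t (\<lambda>_. 1) = (t - a) ^ n / fact n"
  using assms
proof (induction n arbitrary: a)
  case (Suc n)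
  have "ordered_integral (Suc n) a t (\<lambda>_. 1) = (LINT x:{a..t}|lborel. (t - x) ^ n / fact n)"
    unfolding ordered_integral.simps using Suc.IH by (intro set_lebesgue_integral_cong) auto
  also have "\<dots> = (LINT x|lborel. (t - x) ^ n / fact n * indicator {a..t} x)"
    by (simp add: set_lebesgue_integral_def mult.commute)
  also have "\<dots> = - ((t - t) ^ Suc n) / fact (Suc n) - (- ((t - a) ^ Suc n) / fact (Suc n))"
  proof (rule integral_FTC_Icc_real[OF Suc.prems])
    fix x :: real
    have "((\<lambda>x. - ((t - x) ^ Suc n) / fact (Suc n)) has_real_derivative
        - ((1 + real n) * ((0 - 1) * (t - x) ^ n)) / fact (Suc n)) (at x)"
      by (intro DERIV_cdivide DERIV_minus DERIV_power_Suc DERIV_diff DERIV_const DERIV_ident)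
    also have "- ((1 + real n) * ((0 - 1) * (t - x) ^ n)) / fact (Suc n) = (t - x) ^ n / fact n"
      by simp
    finally show "((\<lambda>x. - ((t - x) ^ Suc n) / fact (Suc n)) has_real_derivative (t - x) ^ n / fact n) (at x)" .
    show "isCont (\<lambda>x. (t - x) ^ n / fact n) x" by (intro continuous_intros) auto
  qed
  finally show ?case by simp
qed simp

text \<open>
  Each cell has probability \<open>m\<^bsup>-n\<^esup>\<close> under the uniform law, so the grid average is an integral of
  \<^const>\<open>grid_approx\<close>.
\<close>

lemma grid_average_tendsto_ordered_integral:
  fixes F :: "real list \<Rightarrow> real" and t :: real
  assumes "t > 0"
    and meas: "(\<lambda>x. F (map x [1..<Suc n])) \<in> borel_measurable (Pi\<^sub>M {1..n} (\<lambda>_. borel))"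
    and bound: "\<And>xs. \<bar>F xs\<bar> \<le> B"
    and cont: "\<And>x y. (\<And>j. j \<in> {1..n} \<Longrightarrow> (\<lambda>m. y m j) \<longlonglongrightarrow> x j) \<Longrightarrow>
      (\<lambda>m. F (map (y m) [1..<Suc n])) \<longlonglongrightarrow> F (map x [1..<Suc n])"
  shows "(\<lambda>m. (\<Sum>i\<in>grid_maps n m. F (map (corner t m i) [1..<Suc n])) / real m ^ n)
    \<longlonglongrightarrow> ordered_integral n 0 t F / t ^ n"
proof -
  define U where "U = uniform_measure lborel {0<..t}"
  define \<psi> where "\<psi> x = F (map x [1..<Suc n])" for x
  have emeasure_t: "emeasure lborel {0<..t} = ennreal t" using \<open>t > 0\<close> by simp
  interpret U: prob_space U
    unfolding U_def using \<open>t > 0\<close> by (intro prob_space_uniform_measure) (auto simp: emeasure_t)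
  interpret product_prob_space "\<lambda>_::nat. U" "{1..n}" by unfold_locales
  have [measurable_cong, simp]: "sets U = sets borel" by (simp add: U_def)
  have [simp]: "space U = UNIV" by (simp add: U_def)
  have sets_eq: "sets (Pi\<^sub>M {1..n} (\<lambda>_. U)) = sets (Pi\<^sub>M {1..n} (\<lambda>_. borel))"
    by (intro sets_PiM_cong) auto
  have meas_\<psi> [measurable]: "\<psi> \<in> borel_measurable (Pi\<^sub>M {1..n} (\<lambda>_. U))"
    unfolding \<psi>_def using meas measurable_cong_sets[OF sets_eq refl] by blast
  have meas_cells [measurable]: "Measurable.pred (Pi\<^sub>M {1..n} (\<lambda>_. U)) (in_cells t m n i)" for m i
    unfolding in_cells_def by measurable
  \<comment> \<open>The grid covers only \<open>(0, t]\<close>, which carries the uniform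
    law.\<close>
  have AE_range: "AE x in Pi\<^sub>M {1..n} (\<lambda>_. U). \<forall>j\<in>{1..n}. 0 < x j \<and> x j \<le> t"
  proof (rule AE_finite_allI)
    fix j assume "j \<in> {1..n}"
    moreover have "AE y in U. 0 < y \<and> y \<le> t"
      unfolding U_def by (rule AE_uniform_measureI) auto
    ultimately show "AE x in Pi\<^sub>M {1..n} (\<lambda>_. U). 0 < x j \<and> x j \<le> t"
      by (rule AE_component)
  qed simp
  have cell_prob: "prob {x \<in> space (Pi\<^sub>M {1..n} (\<lambda>_. U)). in_cells t m n i x} = 1 / real m ^ n"
    if "m > 0" "i \<in> grid_maps n m" for m i
  proof -
    define d where "d = t / real m"
    have d: "d > 0" using \<open>t > 0\<close> that by (simp add: d_def)
    have im: "i j < m" if "j \<in> {1..n}" for j using that \<open>i \<in> grid_maps n m\<close> by (auto simp: grid_maps_def)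
    have "measure U {real (i j) * d<..real (Suc (i j)) * d} = 1 / real m" if j: "j \<in> {1..n}" for j
    proof -
      have "real (Suc (i j)) * d \<le> real m * d" using im[OF j] d by (intro mult_right_mono) auto
      then have le: "real (Suc (i j)) * d \<le> t" using \<open>m > 0\<close> by (simp add: d_def)
      moreover have "real (i j) * d \<ge> 0" using d by simp
      ultimately have "{0<..t} \<inter> {real (i j) * d<..real (Suc (i j)) * d} = {real (i j) * d<..real (Suc (i j)) * d}"
        by (auto intro: order_le_less_trans)
      then have "measure U {real (i j) * d<..real (Suc (i j)) * d}
          = measure lborel {real (i j) * d<..real (Suc (i j)) * d} / measure lborel {0<..t}"
        unfolding U_def using \<open>t > 0\<close> by (subst measure_uniform_measure) (auto simp: emeasure_t)
      also have "\<dots> = d / t" using d \<open>t > 0\<close> by (simp add: distrib_right)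
      finally show ?thesis using \<open>t > 0\<close> by (simp add: d_def)
    qed
    moreover have "{x \<in> space (Pi\<^sub>M {1..n} (\<lambda>_. U)). in_cells t m n i x}
        = prod_emb {1..n} (\<lambda>_. U) {1..n} (Pi\<^sub>E {1..n} (\<lambda>j. {real (i j) * d<..real (Suc (i j)) * d}))"
      unfolding in_cells_def d_def[symmetric]
      by (subst prod_emb_PiE_same_index) (auto simp: space_PiM PiE_def Pi_iff)
    ultimately show ?thesis
      using measure_PiM_emb[of "{1..n}" "\<lambda>j. {real (i j) * d<..real (Suc (i j)) * d}"]
      by (simp add: power_one_over del: of_nat_Suc prod_emb_PiE_same_index)
  qed
  have grid_integral: "expectation (grid_approx t m n \<psi>) = (\<Sum>i\<in>grid_maps n m. \<psi> (corner t m i)) / real m ^ n"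
    if "m > 0" for m
  proof -
    have int: "integrable (Pi\<^sub>M {1..n} (\<lambda>_. U)) (indicat_real {x \<in> space (Pi\<^sub>M {1..n} (\<lambda>_. U)). in_cells t m n i x})" for i
    proof (rule integrable_const_bound[where B = 1])
      show "indicat_real {x \<in> space (Pi\<^sub>M {1..n} (\<lambda>_. U)). in_cells t m n i x}
          \<in> borel_measurable (Pi\<^sub>M {1..n} (\<lambda>_. U))"
        by measurable
    qed auto
    have "expectation (grid_approx t m n \<psi>)
      = (\<Sum>i\<in>grid_maps n m. expectation (\<lambda>x. indicator {x \<in> space (Pi\<^sub>M {1..n} (\<lambda>_. U)). in_cells t m n i x} x *\<^sub>R \<psi> (corner t m i)))"
      unfolding grid_approx_def
      by (subst Bochner_Integration.integral_sum[symmetric], use int in simp)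
         (auto intro!: Bochner_Integration.integral_cong sum.cong split: split_indicator)
    also have "\<dots> = (\<Sum>i\<in>grid_maps n m. \<psi> (corner t m i) / real m ^ n)"
    proof (intro sum.cong refl)
      fix i assume i: "i \<in> grid_maps n m"
      have "{x \<in> space (Pi\<^sub>M {1..n} (\<lambda>_. U)). in_cells t m n i x} \<inter> space (Pi\<^sub>M {1..n} (\<lambda>_. U))
          = {x \<in> space (Pi\<^sub>M {1..n} (\<lambda>_. U)). in_cells t m n i x}" by auto
      then show "expectation (\<lambda>x. indicator {x \<in> space (Pi\<^sub>M {1..n} (\<lambda>_. U)). in_cells t m n i x} x *\<^sub>R \<psi> (corner t m i))
          = \<psi> (corner t m i) / real m ^ n"
        using cell_prob[OF that i] int by (simp del: One_nat_def)
    qed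
    finally show ?thesis by (simp add: sum_divide_distrib)
  qed
  have "(\<lambda>m. expectation (grid_approx t m n \<psi>))
      \<longlonglongrightarrow> expectation (\<lambda>x. of_bool (sorted_wrt (<) (0 # map x [1..<Suc n])) * F (map x [1..<Suc n]))"
  proof (rule integral_dominated_convergence[where w = "\<lambda>_. B"])
    have [measurable]: "Measurable.pred (Pi\<^sub>M {1..n} (\<lambda>_. U)) (\<lambda>x. sorted_wrt (<) (map x [1..<Suc n]))"
      by (rule pred_sorted_wrt_PiM) auto
    have "Measurable.pred (Pi\<^sub>M {1..n} (\<lambda>_. U)) (\<lambda>x. (\<forall>j\<in>{1..n}. 0 < x j) \<and> sorted_wrt (<) (map x [1..<Suc n]))"
      by measurable
    also have "(\<lambda>x. (\<forall>j\<in>{1..n}. 0 < x j) \<and> sorted_wrt (<) (map x [1..<Suc n]))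
        = (\<lambda>x. sorted_wrt (<) (0 # map x [1..<Suc n]))"
      by (auto simp: fun_eq_iff simp del: upt_Suc)
    finally have [measurable]: "Measurable.pred (Pi\<^sub>M {1..n} (\<lambda>_. U)) (\<lambda>x. sorted_wrt (<) (0 # map x [1..<Suc n]))" .
    show "(\<lambda>x. of_bool (sorted_wrt (<) (0 # map x [1..<Suc n])) * F (map x [1..<Suc n]))
        \<in> borel_measurable (Pi\<^sub>M {1..n} (\<lambda>_. U))"
      using meas_\<psi> unfolding \<psi>_def[abs_def] by measurable
    show "grid_approx t m n \<psi> \<in> borel_measurable (Pi\<^sub>M {1..n} (\<lambda>_. U))" for m
      unfolding grid_approx_def[abs_def] by measurable
    show "AE x in Pi\<^sub>M {1..n} (\<lambda>_. U). norm (grid_approx t m n \<psi> x) \<le> B" for m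
      using bound by (intro AE_I2 norm_grid_approx_le) (auto simp: \<psi>_def)
    show "AE x in Pi\<^sub>M {1..n} (\<lambda>_. U). (\<lambda>m. grid_approx t m n \<psi> x)
        \<longlonglongrightarrow> of_bool (sorted_wrt (<) (0 # map x [1..<Suc n])) * F (map x [1..<Suc n])"
      using AE_range
    proof eventually_elim
      case (elim x)
      have "(\<lambda>m. grid_approx t m n \<psi> x) \<longlonglongrightarrow> of_bool (strict_mono_on {1..n} x) *\<^sub>R \<psi> x"
        by (rule grid_approx_tendsto[OF \<open>t > 0\<close>]) (use elim cont in \<open>auto simp: \<psi>_def\<close>)
      \<comment> \<open>All coordinates are positive here, so the leading 0 adds no
        constraint.\<close>
      moreover have "strict_mono_on {1..n} x \<longleftrightarrow> sorted_wrt (<) (0 # map x [1..<Suc n])"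
        using elim sorted_wrt_map_upt_iff[of x n] by (auto simp del: upt_Suc)
      ultimately show ?case by (simp add: \<psi>_def)
    qed
  qed (rule integrable_const)
  also have "expectation (\<lambda>x. of_bool (sorted_wrt (<) (0 # map x [1..<Suc n])) * F (map x [1..<Suc n]))
      = ordered_integral n 0 t F / t ^ n"
    using ordered_integral_eq_PiM[of t "[1..<Suc n]" 0 F B] \<open>t > 0\<close> bound meas_\<psi>
    by (simp add: U_def \<psi>_def[abs_def] atLeastLessThanSuc_atLeastAtMost del: upt_Suc)
  finally show ?thesis
  proof (rule Lim_transform_eventually)
    show "\<forall>\<^sub>F m in sequentially. expectation (grid_approx t m n \<psi>)
        = (\<Sum>i\<in>grid_maps n m. F (map (corner t m i) [1..<Suc n])) / real m ^ n"
      using eventually_gt_at_top[of 0]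
      by eventually_elim (simp only: grid_integral, simp only: \<psi>_def)
  qed
qed

section \<open>Increments and event times of the Poisson process\<close>

text \<open>Reading the indicator as a complex random variable gives both factors the same type, so
  the product rule for independent variables applies; their generated sigma-algebras lie inside
  \<open>\<A>\<close> and \<open>\<B>\<close>.\<close>

lemma (in prob_space) expectation_indicator_indep:
  fixes Y :: "'a \<Rightarrow> complex"
  assumes indep: "indep_set (sets \<A>) (sets \<B>)"
    and [simp]: "space \<A> = space M" "space \<B> = space M"
    and B: "B \<in> sets \<A>" and Y: "Y \<in> borel_measurable \<B>" and bound: "\<And>\<omega>. norm (Y \<omega>) \<le> C"
  shows "expectation (\<lambda>\<omega>. indicator B \<omega> *\<^sub>R Y \<omega>) = prob B *\<^sub>R expectation Y"
proof -
  define I :: "'a \<Rightarrow> complex" where "I = (\<lambda>\<omega>. of_real (indicator B \<omega>))"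
  have I: "I \<in> borel_measurable \<A>" unfolding I_def using B by measurable
  have sub: "sets \<A> \<subseteq> events" "sets \<B> \<subseteq> events"
    using indep by (auto dest: indep_setD_ev1 indep_setD_ev2)
  have rv: "random_variable borel I" "random_variable borel Y"
    using measurable_mono[OF order_refl refl sub(1)] measurable_mono[OF order_refl refl sub(2)] I Y
    by auto
  have "sigma_sets (space M) {I -` A \<inter> space M |A. A \<in> sets borel} \<subseteq> sets \<A>"
    using sets.sigma_sets_subset[of "{I -` A \<inter> space M |A. A \<in> sets borel}" \<A>] measurable_sets[OF I]
    by auto
  moreover have "sigma_sets (space M) {Y -` A \<inter> space M |A. A \<in> sets borel} \<subseteq> sets \<B>"
    using sets.sigma_sets_subset[of "{Y -` A \<inter> space M |A. A \<in> sets borel}" \<B>] measurable_sets[OF Y]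
    by auto
  ultimately have "indep_var borel I borel Y"
    unfolding indep_var_eq using rv indep
    by (auto simp: indep_set_def elim!: indep_sets_mono_sets split: bool.splits)
  then have "expectation (\<lambda>\<omega>. I \<omega> * Y \<omega>) = expectation I * expectation Y"
  proof (rule indep_var_lebesgue_integral)
    show "integrable M I"
      by (rule integrable_const_bound[where B = 1]) (use rv in \<open>auto simp: I_def indicator_def\<close>)
    show "integrable M Y"
      by (rule integrable_const_bound[where B = C]) (use rv bound in auto)
  qed
  moreover have "expectation I = of_real (prob B)"
    unfolding I_def using B sub sets.sets_into_space by (subst integral_complex_of_real) (auto simp: Int_absorb2)
  ultimately show ?thesis by (simp add: I_def scaleR_conv_of_real)
qed

lemma event_time_nonneg:
  assumes "0 \<le> t" "j \<le> N t \<omega>"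
  shows "0 \<le> event_time N j \<omega>"
  unfolding event_time_def by (rule cInf_greatest) (use assms in auto)

text \<open>The point is that the infimum is attained: an integer-valued right-continuous path is
  constant just after the infimum, so level \<open>j\<close> is already reached there. The condition
  at \<open>t\<close> makes the set nonempty.\<close>

lemma event_time_le_iff:
  assumes mono: "\<And>u v. 0 \<le> u \<Longrightarrow> u \<le> v \<Longrightarrow> N u \<omega> \<le> N v \<omega>"
    and cont: "\<And>u. 0 \<le> u \<Longrightarrow> continuous (at_right u) (\<lambda>v. N v \<omega>)"
    and t: "0 \<le> t" "j \<le> N t \<omega>" and u: "0 \<le> u"
  shows "event_time N j \<omega> \<le> u \<longleftrightarrow> j \<le> N u \<omega>"
proof
  assume "j \<le> N u \<omega>"
  then show "event_time N j \<omega> \<le> u"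
    unfolding event_time_def by (intro cInf_lower) (use u in auto)
next
  define e where "e = event_time N j \<omega>"
  have e: "0 \<le> e" unfolding e_def using t by (rule event_time_nonneg)
  have "((\<lambda>v. N v \<omega>) \<longlongrightarrow> N e \<omega>) (at_right e)"
    using cont[OF e] by (simp add: continuous_within)
  then have "\<forall>\<^sub>F v in at_right e. N v \<omega> = N e \<omega>"
    by (simp add: tendsto_discrete)
  then obtain b where b: "b > e" "\<And>v. e < v \<Longrightarrow> v < b \<Longrightarrow> N v \<omega> = N e \<omega>"
    by (auto simp: eventually_at_right_field)
  \<comment> \<open>Some time in the set lies before \<open>b\<close>, hence where the path still
    has the value \<open>N e \<omega>\<close>.\<close>
  have "\<exists>a\<in>{u. 0 \<le> u \<and> j \<le> N u \<omega>}. a < b"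
    using b(1) unfolding e_def event_time_def by (intro cInf_lessD) (use t in auto)
  then obtain a where a: "0 \<le> a" "j \<le> N a \<omega>" "a < b" by auto
  then have "e \<le> a" unfolding e_def event_time_def by (intro cInf_lower) auto
  then have "j \<le> N e \<omega>" using a b(2)[of a] by (cases "a = e") auto
  moreover assume "event_time N j \<omega> \<le> u"
  ultimately show "j \<le> N u \<omega>" using mono[OF e] by (metis e_def le_trans)
qed

section \<open>Common hypotheses and the two generated sigma-algebras\<close>

locale poisson_flight = prob_space M
  for M :: "'a measure" and N :: "real \<Rightarrow> 'a \<Rightarrow> nat" and \<theta> :: "nat \<Rightarrow> 'a \<Rightarrow> real"
    and rate \<nu> :: real +
  assumes nu_nonneg: "\<nu> \<ge> 0"
    and poisson: "poisson_process M rate N"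
    and indep_angles: "indep_vars (\<lambda>_. borel) \<theta> {1..}"
    and angles: "\<And>j. j \<ge> 1 \<Longrightarrow> distributed M lborel (\<theta> j) (\<lambda>x. ennreal (angle_density \<nu> x))"
    and indep_process_angles: "indep_elements M
       (Pi\<^sub>M {0..} (\<lambda>_. count_space UNIV)) (\<lambda>\<omega>. \<lambda>u\<in>{0..}. N u \<omega>)
       (Pi\<^sub>M {1..} (\<lambda>_. borel)) (\<lambda>\<omega>. \<lambda>j\<in>{1..}. \<theta> j \<omega>)"
begin

abbreviation "sigma_N \<equiv> vimage_algebra (space M) (\<lambda>\<omega>. \<lambda>u\<in>{0..}. N u \<omega>) (Pi\<^sub>M {0..} (\<lambda>_. count_space UNIV))"

abbreviation "sigma_\<theta> \<equiv> vimage_algebra (space M) (\<lambda>\<omega>. \<lambda>j\<in>{1..}. \<theta> j \<omega>) (Pi\<^sub>M {1..} (\<lambda>_. borel))"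

lemma rate_pos: "rate > 0"
  and N_0: "\<omega> \<in> space M \<Longrightarrow> N 0 \<omega> = 0"
  and N_mono: "\<omega> \<in> space M \<Longrightarrow> 0 \<le> u \<Longrightarrow> u \<le> v \<Longrightarrow> N u \<omega> \<le> N v \<omega>"
  and N_right_continuous: "\<omega> \<in> space M \<Longrightarrow> 0 \<le> u \<Longrightarrow> continuous (at_right u) (\<lambda>v. N v \<omega>)"
  and N_increment: "0 \<le> u \<Longrightarrow> u < v \<Longrightarrow> distr M (count_space UNIV) (\<lambda>\<omega>. N v \<omega> - N u \<omega>) = measure_pmf (poisson_pmf (rate * (v - u)))"
  and measurable_N: "0 \<le> u \<Longrightarrow> N u \<in> M \<rightarrow>\<^sub>M count_space UNIV"
  using poisson unfolding poisson_process_def by blast+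

lemma N_indep_increments:
  "0 \<le> u 0 \<Longrightarrow> (\<And>k. k < n \<Longrightarrow> u k < u (Suc k)) \<Longrightarrow>
    indep_vars (\<lambda>_. count_space UNIV) (\<lambda>k \<omega>. N (u (Suc k)) \<omega> - N (u k) \<omega>) {..<n}"
  using poisson unfolding poisson_process_def by blast

lemma measurable_N_sigma_N: "0 \<le> u \<Longrightarrow> N u \<in> sigma_N \<rightarrow>\<^sub>M count_space UNIV"
proof -
  assume u: "0 \<le> u"
  have "(\<lambda>\<omega>. \<lambda>u\<in>{0..}. N u \<omega>) \<in> sigma_N \<rightarrow>\<^sub>M Pi\<^sub>M {0..} (\<lambda>_. count_space UNIV)"
    by (rule measurable_vimage_algebra1) (auto simp: space_PiM)
  from measurable_compose[OF this measurable_component_singleton[of u]] u show ?thesis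
    by simp
qed

lemma measurable_\<theta>_sigma_\<theta>: "1 \<le> j \<Longrightarrow> \<theta> j \<in> sigma_\<theta> \<rightarrow>\<^sub>M borel"
proof -
  assume j: "1 \<le> j"
  have "(\<lambda>\<omega>. \<lambda>j\<in>{1..}. \<theta> j \<omega>) \<in> sigma_\<theta> \<rightarrow>\<^sub>M Pi\<^sub>M {1..} (\<lambda>_. borel)"
    by (rule measurable_vimage_algebra1) (auto simp: space_PiM)
  from measurable_compose[OF this measurable_component_singleton[of j]] j show ?thesis
    by simp
qed

lemma measurable_\<theta>: "1 \<le> j \<Longrightarrow> \<theta> j \<in> borel_measurable M"
  using distributed_measurable[OF angles] by simp

lemma event_time_le:
  assumes "\<omega> \<in> space M" "0 \<le> t" "j \<le> N t \<omega>" "0 \<le> u"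
  shows "event_time N j \<omega> \<le> u \<longleftrightarrow> j \<le> N u \<omega>"
  by (rule event_time_le_iff[OF N_mono N_right_continuous]) (use assms in auto)

section \<open>Probabilities of increment configurations\<close>

lemma prob_N_eq:
  assumes "t > 0"
  shows "prob {\<omega> \<in> space M. N t \<omega> = n} = exp (- (rate * t)) * (rate * t) ^ n / fact n"
proof -
  have "prob {\<omega> \<in> space M. N t \<omega> = n} = measure (distr M (count_space UNIV) (\<lambda>\<omega>. N t \<omega> - N 0 \<omega>)) {n}"
    using measurable_N[of t] measurable_N[of 0] assms
    by (subst measure_distr) (auto simp: N_0 intro!: arg_cong[where f = prob])
  also have "\<dots> = pmf (poisson_pmf (rate * t)) n"
    using assms by (subst N_increment) (auto simp: measure_pmf_single)
  finally show ?thesis using assms rate_pos by (simp add: mult_ac)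
qed

text \<open>Stated through increments, not event times: in this form both membership in
  \<open>sigma_N\<close> and the probability follow directly from the process.\<close>

definition increment_event :: "real \<Rightarrow> nat \<Rightarrow> nat \<Rightarrow> (nat \<Rightarrow> nat) \<Rightarrow> 'a set" where
  "increment_event t m n i = {\<omega> \<in> space M. \<forall>k<m.
     N (real (Suc k) * (t / real m)) \<omega> - N (real k * (t / real m)) \<omega> = of_bool (k \<in> i ` {1..n})}"

text \<open>Apply \<open>increments_iff\<close> to the path sampled at the grid points, then
  translate levels reached into event times by \<open>event_time_le\<close>.\<close>

lemma increment_event_iff:
  assumes "t > 0" "m > 0" "i \<in> grid_maps n m" "\<omega> \<in> space M"
  shows "\<omega> \<in> increment_event t m n i \<longleftrightarrow>
    N t \<omega> = n \<and> in_cells t m n i (\<lambda>j. event_time N j \<omega>)"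
proof -
  define f where "f k = N (real k * (t / real m)) \<omega>" for k
  have "mono f"
    unfolding f_def mono_def using assms by (intro allI impI N_mono mult_right_mono) auto
  moreover have "f 0 = 0" using assms by (simp add: f_def N_0)
  ultimately have "\<omega> \<in> increment_event t m n i \<longleftrightarrow>
      f m = n \<and> (\<forall>j\<in>{1..n}. f (i j) < j \<and> j \<le> f (Suc (i j)))"
    using increments_iff[OF assms(3), of f] assms by (simp add: increment_event_def f_def del: of_nat_Suc)
  also have "f m = N t \<omega>" using assms by (simp add: f_def)
  also have "(N t \<omega> = n \<and> (\<forall>j\<in>{1..n}. f (i j) < j \<and> j \<le> f (Suc (i j)))) \<longleftrightarrow>
      N t \<omega> = n \<and> in_cells t m n i (\<lambda>j. event_time N j \<omega>)"
    unfolding in_cells_def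
  proof (intro conj_cong refl ball_cong)
    fix j assume j: "N t \<omega> = n" "j \<in> {1..n}"
    have *: "event_time N j \<omega> \<le> real k * (t / real m) \<longleftrightarrow> j \<le> f k" for k
      unfolding f_def by (rule event_time_le[OF assms(4), of t]) (use j assms in auto)
    show "f (i j) < j \<longleftrightarrow> real (i j) * (t / real m) < event_time N j \<omega>"
      by (simp only: not_le[symmetric] *)
    show "j \<le> f (Suc (i j)) \<longleftrightarrow> event_time N j \<omega> \<le> real (Suc (i j)) * (t / real m)"
      by (simp only: *)
  qed
  finally show ?thesis .
qed

lemma increment_event_sigma_N:
  assumes "t > 0"
  shows "increment_event t m n i \<in> sets sigma_N"
proof (cases "m = 0")
  case True
  then have "increment_event t m n i = space sigma_N" by (simp add: increment_event_def)
  then show ?thesis by (metis sets.top)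
next
  case False
  have [measurable]: "N (real k * (t / real m)) \<in> sigma_N \<rightarrow>\<^sub>M count_space UNIV" for k
    using assms by (intro measurable_N_sigma_N) auto
  have D: "(\<lambda>\<omega>. N (real (Suc k) * (t / real m)) \<omega> - N (real k * (t / real m)) \<omega>) \<in> sigma_N \<rightarrow>\<^sub>M count_space UNIV" for k
    by measurable
  have "{\<omega> \<in> space sigma_N. \<forall>k\<in>{..<m}.
      N (real (Suc k) * (t / real m)) \<omega> - N (real k * (t / real m)) \<omega> = of_bool (k \<in> i ` {1..n})} \<in> sets sigma_N"
  proof (rule sets.sets_Collect_finite_All')
    fix k
    show "{\<omega> \<in> space sigma_N. N (real (Suc k) * (t / real m)) \<omega> - N (real k * (t / real m)) \<omega>
        = of_bool (k \<in> i ` {1..n})} \<in> sets sigma_N"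
      using measurable_sets[OF D[of k], of "{of_bool (k \<in> i ` {1..n})}"]
      by (simp only: vimage_def Int_def conj_commute mem_Collect_eq singleton_iff sets_count_space Pow_UNIV UNIV_I simp_thms)
  qed (use False in auto)
  then show ?thesis by (simp only: increment_event_def Ball_def lessThan_iff space_vimage_algebra)
qed

text \<open>The increments are independent Poisson variables, and exactly \<open>n\<close> of the
  prescribed values are 1 since \<open>i\<close> is injective. The result is the same for all
  \<open>i\<close>, which is what makes the sum over cells a plain average.\<close>

lemma prob_increment_event:
  assumes "t > 0" "m > 0" and i: "i \<in> grid_maps n m"
  shows "prob (increment_event t m n i) = exp (- (rate * t)) * (rate * t / real m) ^ n"
proof -
  define d where "d = t / real m"
  define D where "D k \<omega> = N (real (Suc k) * d) \<omega> - N (real k * d) \<omega>" for k \<omega>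
  define b where "b k = (of_bool (k \<in> i ` {1..n}) :: nat)" for k
  have d: "d > 0" using assms by (simp add: d_def)
  have [measurable]: "D k \<in> M \<rightarrow>\<^sub>M count_space UNIV" for k
  proof -
    have [measurable]: "N (real k * d) \<in> M \<rightarrow>\<^sub>M count_space UNIV" for k
      using d by (intro measurable_N) auto
    show ?thesis unfolding D_def by measurable
  qed
  have "increment_event t m n i = (\<Inter>k\<in>{..<m}. D k -` {b k} \<inter> space M)"
    using \<open>m > 0\<close> by (auto simp: increment_event_def D_def b_def d_def)
  also have "prob \<dots> = (\<Prod>k<m. prob (D k -` {b k} \<inter> space M))"
  proof (rule indep_varsD_finite)
    show "indep_vars (\<lambda>_. count_space UNIV) D {..<m}"
      unfolding D_def using d by (intro N_indep_increments) auto
  qed (use \<open>m > 0\<close> in auto)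
  also have "\<dots> = (\<Prod>k<m. exp (- (rate * d)) * (rate * d) ^ b k)"
  proof (intro prod.cong refl)
    fix k
    have "prob (D k -` {b k} \<inter> space M) = measure (distr M (count_space UNIV) (D k)) {b k}"
      by (subst measure_distr) auto
    also have "distr M (count_space UNIV) (D k) = measure_pmf (poisson_pmf (rate * d))"
      unfolding D_def using d by (subst N_increment) (auto simp: distrib_right)
    \<comment> \<open>As \<open>b k\<close> is 0 or 1, the factorial in the Poisson weight is
      1.\<close>
    also have "measure \<dots> {b k} = exp (- (rate * d)) * (rate * d) ^ b k"
      using rate_pos d by (simp add: measure_pmf_single b_def)
    finally show "prob (D k -` {b k} \<inter> space M) = exp (- (rate * d)) * (rate * d) ^ b k" .
  qed
  also have "\<dots> = exp (- (rate * d)) ^ m * (rate * d) ^ (\<Sum>k<m. b k)"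
    by (simp add: prod.distrib power_sum)
  also have "exp (- (rate * d)) ^ m = exp (- (rate * t))"
    using \<open>m > 0\<close> by (simp add: d_def flip: exp_of_nat_mult)
  also have "(\<Sum>k<m. b k) = n"
  proof -
    have "i ` {1..n} \<subseteq> {..<m}" "inj_on i {1..n}"
      using i by (auto simp: grid_maps_def intro: strict_mono_on_imp_inj_on)
    then have "card ({..<m} \<inter> i ` {1..n}) = n"
      by (simp add: card_image Int_absorb1)
    then show ?thesis by (simp add: b_def of_bool_def sum.If_cases Int_def)
  qed
  finally show ?thesis by (simp add: d_def)
qed

end

section \<open>Characteristic function of the motion\<close>

text \<open>The quotient is an everywhere convergent power series evaluated at the negative square
  of \<open>z / 2\<close>.\<close>

lemma isCont_bessel_J_quot:
  assumes "\<nu> \<ge> 0"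
  shows "isCont (bessel_J_quot \<nu>) z"
proof -
  define a where "a k = 1 / (fact k * Gamma (real k + \<nu> + 1))" for k
  have summable_a: "summable (\<lambda>k. a k * w ^ k)" for w :: real
  proof -
    \<comment> \<open>The Bessel series only reaches nonpositive arguments. It is evaluated at one
      of larger modulus than \<open>w\<close>, and convergence at \<open>w\<close> follows.\<close>
    have "a k * (- (\<bar>w\<bar> + 1)) ^ k =
        (-1) ^ k * (2 * sqrt (\<bar>w\<bar> + 1) / 2) ^ (2 * k) / (fact k * Gamma (real k + \<nu> + 1))" for k
      unfolding power_minus[of "\<bar>w\<bar> + 1"] by (simp add: a_def power_mult)
    then have "summable (\<lambda>k. a k * (- (\<bar>w\<bar> + 1)) ^ k)"
      using bessel_J_quot_summable[OF assms, of "2 * sqrt (\<bar>w\<bar> + 1)"] by simp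
    then show ?thesis by (rule powser_inside) auto
  qed
  have "(- ((x / 2)\<^sup>2)) ^ k = (-1) ^ k * (x / 2) ^ (2 * k)" for x :: real and k
    by (simp add: power_minus[of "(x / 2)\<^sup>2"] power_mult)
  then have "bessel_J_quot \<nu> = (\<lambda>x. 2 powr (-\<nu>) * (\<Sum>k. a k * (- ((x / 2)\<^sup>2)) ^ k))"
    by (simp add: bessel_J_quot_def a_def fun_eq_iff)
  moreover have "isCont (\<lambda>w. \<Sum>k. a k * w ^ k) (- ((z / 2)\<^sup>2))"
    by (rule isCont_powser_converges_everywhere[OF summable_a])
  then have "isCont (\<lambda>x. \<Sum>k. a k * (- ((x / 2)\<^sup>2)) ^ k) z"
    by (rule isCont_o2[rotated]) (intro continuous_intros, auto)
  ultimately show ?thesis by (simp add: continuous_intros)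
qed

lemma ordered_integral_cmult:
  "ordered_integral n a t (\<lambda>xs. k * F xs) = k * ordered_integral n a t F"
  by (induction n arbitrary: a F) simp_all

text \<open>The function counterpart of the list \<open>0 # xs @ [t]\<close>: only the values of
  \<open>y\<close> at 1 to \<open>n\<close> matter, and both end conventions are built in.\<close>

definition partition_point :: "nat \<Rightarrow> real \<Rightarrow> (nat \<Rightarrow> real) \<Rightarrow> nat \<Rightarrow> real" where
  "partition_point n t y j = (if j = 0 then 0 else if j = n + 1 then t else y j)"

lemma nth_partition_point:
  assumes "j \<le> n + 1"
  shows "(0 # map y [1..<Suc n] @ [t]) ! j = partition_point n t y j"
  using assms by (cases j) (auto simp: partition_point_def nth_append simp del: upt_Suc)

context poisson_flight
begin

text \<open>Where fewer than \<open>j\<close> events occur by time \<open>t\<close>, the infimum may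
  be over an empty set, so the value is replaced by 0. For \<open>u \<ge> 0\<close> the sublevel set
  is then the event that \<open>j \<le> N t \<omega>\<close> implies
  \<open>j \<le> N u \<omega>\<close>.\<close>

lemma measurable_event_time:
  assumes "t \<ge> 0"
  shows "(\<lambda>\<omega>. if j \<le> N t \<omega> then event_time N j \<omega> else 0) \<in> borel_measurable M"
proof (rule borel_measurableI_le)
  fix u :: real
  show "{\<omega> \<in> space M. (if j \<le> N t \<omega> then event_time N j \<omega> else 0) \<le> u} \<in> events"
  proof (cases "u \<ge> 0")
    case True
    have [measurable]: "N t \<in> M \<rightarrow>\<^sub>M count_space UNIV" "N u \<in> M \<rightarrow>\<^sub>M count_space UNIV"
      using assms True by (auto intro: measurable_N)
    have "{\<omega> \<in> space M. j \<le> N t \<omega> \<longrightarrow> j \<le> N u \<omega>} \<in> events" by measurable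
    also have "{\<omega> \<in> space M. j \<le> N t \<omega> \<longrightarrow> j \<le> N u \<omega>}
        = {\<omega> \<in> space M. (if j \<le> N t \<omega> then event_time N j \<omega> else 0) \<le> u}"
      using event_time_le[OF _ assms _ True] True by auto
    finally show ?thesis .
  next
    case False
    then have "{\<omega> \<in> space M. (if j \<le> N t \<omega> then event_time N j \<omega> else 0) \<le> u} = {}"
      using event_time_nonneg[of t j N] assms by (auto split: if_splits) (meson order_trans)
    then show ?thesis by (metis sets.empty_sets)
  qed
qed

lemma measurable_random_motion:
  assumes "t > 0"
  shows "random_motion c N \<theta> t \<in> borel_measurable M"
proof -
  define e where "e j \<omega> = (if j \<le> N t \<omega> then event_time N j \<omega> else 0)" for j \<omega>
  \<comment> \<open>Fixing the number of events gives a finite sum of measurable terms;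
    \<open>N t\<close>, with its countable range, is substituted afterwards.\<close>
  define X where "X n \<omega> = c * (\<Sum>j=1..n + 1. (partition_point n t (\<lambda>j. e j \<omega>) j
      - partition_point n t (\<lambda>j. e j \<omega>) (j - 1)) * cos (\<theta> j \<omega>))" for n \<omega>
  have [measurable]: "e j \<in> borel_measurable M" for j
    unfolding e_def using assms by (intro measurable_event_time) auto
  have [measurable]: "(\<lambda>\<omega>. partition_point n t (\<lambda>j. e j \<omega>) j) \<in> borel_measurable M" for n j
    unfolding partition_point_def by measurable
  have [measurable]: "X n \<in> borel_measurable M" for n
    unfolding X_def
    by (intro borel_measurable_times borel_measurable_sum borel_measurable_diff
        borel_measurable_const measurable_compose[OF measurable_\<theta> borel_measurable_cos]) auto
  have [measurable]: "N t \<in> M \<rightarrow>\<^sub>M count_space UNIV" using assms by (intro measurable_N) auto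
  have "(\<lambda>\<omega>. X (N t \<omega>) \<omega>) \<in> borel_measurable M" by measurable
  also have "(\<lambda>\<omega>. X (N t \<omega>) \<omega>) = random_motion c N \<theta> t"
    unfolding X_def random_motion_def
    by (intro ext arg_cong[where f = "(*) c"] sum.cong refl)
       (auto simp: partition_point_def event_time_upto_def e_def event_time_0)
  finally show ?thesis .
qed

section \<open>The motion with deterministic event times\<close>

definition angle_char :: "real \<Rightarrow> real" where
  "angle_char z = 2 powr \<nu> * Gamma (\<nu> + 1) * bessel_J_quot \<nu> z"

lemma expectation_angle:
  assumes "j \<ge> 1"
  shows "expectation (\<lambda>\<omega>. exp (\<i> * complex_of_real (z * cos (\<theta> j \<omega>)))) = complex_of_real (angle_char z)"
  unfolding angle_char_def by (rule char_cos_angle[OF nu_nonneg angles[OF assms]])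

text \<open>The bound comes from the expectation of a unimodular variable, not from the Bessel
  series.\<close>

lemma abs_angle_char_le: "\<bar>angle_char z\<bar> \<le> 1"
proof -
  have "\<bar>angle_char z\<bar> = norm (expectation (\<lambda>\<omega>. exp (\<i> * complex_of_real (z * cos (\<theta> 1 \<omega>)))))"
    by (simp only: expectation_angle[OF order_refl] norm_of_real)
  also have "\<dots> \<le> expectation (\<lambda>\<omega>. norm (exp (\<i> * complex_of_real (z * cos (\<theta> 1 \<omega>)))))"
    by (rule integral_norm_bound)
  also have "\<dots> = 1" by (simp add: prob_space)
  finally show ?thesis .
qed

lemma isCont_angle_char: "isCont angle_char z"
  unfolding angle_char_def[abs_def] by (intro continuous_intros isCont_bessel_J_quot nu_nonneg)

lemma borel_measurable_angle_char [measurable]: "angle_char \<in> borel_measurable borel"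
  by (intro borel_measurable_continuous_onI continuous_at_imp_continuous_on ballI isCont_angle_char)

text \<open>The event times are frozen at \<open>y\<close>, so only the angles are random, and the
  product has one factor per angle.\<close>

definition path_exp :: "real \<Rightarrow> real \<Rightarrow> nat \<Rightarrow> (nat \<Rightarrow> real) \<Rightarrow> 'a \<Rightarrow> complex" where
  "path_exp b t n y \<omega> = (\<Prod>j=1..n + 1. exp (\<i> * complex_of_real
     (b * (partition_point n t y j - partition_point n t y (j - 1)) * cos (\<theta> j \<omega>))))"

lemma norm_path_exp: "norm (path_exp b t n y \<omega>) = 1"
  unfolding path_exp_def by (simp only: prod_norm[symmetric] norm_exp_i_times prod.neutral_const)

lemma path_exp_sigma_\<theta>: "path_exp b t n y \<in> borel_measurable sigma_\<theta>"
  unfolding path_exp_def[abs_def]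
proof (intro borel_measurable_prod)
  fix j assume "j \<in> {1..n + 1}"
  then have [measurable]: "\<theta> j \<in> borel_measurable sigma_\<theta>" by (intro measurable_\<theta>_sigma_\<theta>) auto
  show "(\<lambda>\<omega>. exp (\<i> * complex_of_real (b * (partition_point n t y j - partition_point n t y (j - 1)) * cos (\<theta> j \<omega>))))
      \<in> borel_measurable sigma_\<theta>"
    by measurable
qed

lemma expectation_path_exp:
  "expectation (path_exp b t n y) = complex_of_real
     (\<Prod>j=1..n + 1. angle_char (b * (partition_point n t y j - partition_point n t y (j - 1))))"
proof -
  define g where "g j \<omega> = exp (\<i> * complex_of_real
      (b * (partition_point n t y j - partition_point n t y (j - 1)) * cos (\<theta> j \<omega>)))" for j \<omega>
  have "indep_vars (\<lambda>_. borel) g {1..n + 1}"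
    unfolding g_def
    by (rule indep_vars_compose2[OF indep_vars_subset[OF indep_angles]]) auto
  then have "expectation (\<lambda>\<omega>. \<Prod>j=1..n + 1. g j \<omega>) = (\<Prod>j=1..n + 1. expectation (g j))"
  proof (intro indep_vars_lebesgue_integral)
    fix j assume j: "j \<in> {1..n + 1}"
    then have [measurable]: "\<theta> j \<in> borel_measurable M" by (intro measurable_\<theta>) auto
    show "integrable M (g j)"
      by (rule integrable_const_bound[where B = 1]) (auto simp: g_def[abs_def])
  qed auto
  also have "\<dots> = (\<Prod>j=1..n + 1. complex_of_real (angle_char (b * (partition_point n t y j - partition_point n t y (j - 1)))))"
    unfolding g_def by (intro prod.cong refl expectation_angle) auto
  finally show ?thesis by (simp only: g_def path_exp_def[abs_def] of_real_prod)
qed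

lemma path_exp_tendsto:
  assumes "\<And>j. j \<in> {1..n} \<Longrightarrow> (\<lambda>m. y m j) \<longlonglongrightarrow> x j"
  shows "(\<lambda>m. path_exp b t n (y m) \<omega>) \<longlonglongrightarrow> path_exp b t n x \<omega>"
proof -
  have "(\<lambda>m. partition_point n t (y m) j) \<longlonglongrightarrow> partition_point n t x j" if "j \<le> n + 1" for j
    using that assms[of j] by (auto simp: partition_point_def)
  then show ?thesis
    unfolding path_exp_def by (intro tendsto_intros) auto
qed

lemma path_exp_event_times:
  assumes "N t \<omega> = n"
  shows "path_exp (\<alpha> * c) t n (\<lambda>j. event_time N j \<omega>) \<omega> = exp (\<i> * complex_of_real (\<alpha> * random_motion c N \<theta> t \<omega>))"
proof -
  have "event_time_upto N t j \<omega> = partition_point n t (\<lambda>j. event_time N j \<omega>) j" for j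
    using assms by (auto simp: event_time_upto_def partition_point_def event_time_0)
  then have "\<i> * complex_of_real (\<alpha> * random_motion c N \<theta> t \<omega>) = (\<Sum>j=1..n + 1. \<i> * complex_of_real
     (\<alpha> * c * (partition_point n t (\<lambda>j. event_time N j \<omega>) j - partition_point n t (\<lambda>j. event_time N j \<omega>) (j - 1)) * cos (\<theta> j \<omega>)))"
    by (simp only: random_motion_def assms sum_distrib_left of_real_sum mult.assoc)
  then show ?thesis
    by (simp only: path_exp_def exp_sum finite_atLeastAtMost)
qed

text \<open>Written on lists because \<open>ordered_integral\<close> takes functions of lists;
  \<open>path_char_map\<close> identifies it with the expectation of
  \<open>path_exp\<close>.\<close>

definition path_char :: "real \<Rightarrow> real \<Rightarrow> nat \<Rightarrow> real list \<Rightarrow> real" where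
  "path_char b t n xs = (\<Prod>j=1..n + 1. angle_char (b * ((0 # xs @ [t]) ! j - (0 # xs @ [t]) ! (j - 1))))"

lemma path_char_map:
  "path_char b t n (map y [1..<Suc n]) =
     (\<Prod>j=1..n + 1. angle_char (b * (partition_point n t y j - partition_point n t y (j - 1))))"
  unfolding path_char_def
proof (intro prod.cong refl)
  fix j assume "j \<in> {1..n + 1}"
  then have "j \<le> n + 1" "j - 1 \<le> n + 1" by auto
  then show "angle_char (b * ((0 # map y [1..<Suc n] @ [t]) ! j - (0 # map y [1..<Suc n] @ [t]) ! (j - 1)))
      = angle_char (b * (partition_point n t y j - partition_point n t y (j - 1)))"
    by (simp only: nth_partition_point)
qed

lemma path_char_grid_average:
  assumes "t > 0"
  shows "(\<lambda>m. (\<Sum>i\<in>grid_maps n m. path_char b t n (map (corner t m i) [1..<Suc n])) / real m ^ n)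
    \<longlonglongrightarrow> ordered_integral n 0 t (path_char b t n) / t ^ n"
proof (rule grid_average_tendsto_ordered_integral[OF assms])
  have meas_point: "(\<lambda>x. partition_point n t x j) \<in> borel_measurable (Pi\<^sub>M {1..n} (\<lambda>_. borel))"
    if "j \<le> n + 1" for j
    using that by (cases "j = 0 \<or> j = n + 1") (auto simp: partition_point_def)
  show "(\<lambda>x. path_char b t n (map x [1..<Suc n])) \<in> borel_measurable (Pi\<^sub>M {1..n} (\<lambda>_. borel))"
    unfolding path_char_map
  proof (intro borel_measurable_prod)
    fix j assume "j \<in> {1..n + 1}"
    then have "j \<le> n + 1" "j - 1 \<le> n + 1" by auto
    note [measurable] = this[THEN meas_point]
    show "(\<lambda>x. angle_char (b * (partition_point n t x j - partition_point n t x (j - 1))))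
        \<in> borel_measurable (Pi\<^sub>M {1..n} (\<lambda>_. borel))"
      by measurable
  qed
  show "\<bar>path_char b t n xs\<bar> \<le> 1" for xs
    unfolding path_char_def abs_prod by (intro prod_le_1) (use abs_angle_char_le in auto)
  fix x y assume lim: "\<And>j. j \<in> {1..n} \<Longrightarrow> (\<lambda>m. y m j :: real) \<longlonglongrightarrow> x j"
  have point: "(\<lambda>m. partition_point n t (y m) j) \<longlonglongrightarrow> partition_point n t x j" if "j \<le> n + 1" for j
    using that lim[of j] by (auto simp: partition_point_def)
  show "(\<lambda>m. path_char b t n (map (y m) [1..<Suc n])) \<longlonglongrightarrow> path_char b t n (map x [1..<Suc n])"
    unfolding path_char_map
  proof (intro tendsto_prod isCont_tendsto_compose[OF isCont_angle_char] tendsto_mult_left tendsto_diff)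
    fix j assume "j \<in> {1..n + 1}"
    then have le: "j \<le> n + 1" "j - 1 \<le> n + 1" by auto
    show "(\<lambda>m. partition_point n t (y m) j) \<longlonglongrightarrow> partition_point n t x j"
      by (rule point[OF le(1)])
    show "(\<lambda>m. partition_point n t (y m) (j - 1)) \<longlonglongrightarrow> partition_point n t x (j - 1)"
      by (rule point[OF le(2)])
  qed
qed

text \<open>The grid argument yields the limit only on strictly ordered event times, hence the extra
  condition in \<open>E\<close>. It is removed afterwards, using this very identity.\<close>

lemma expectation_ordered_event_times:
  fixes n :: nat and \<alpha> c t :: real
  assumes "t > 0"
  defines "E \<equiv> \<lambda>\<omega>. N t \<omega> = n \<and> strict_mono_on {1..n} (\<lambda>j. event_time N j \<omega>)"
  shows "(\<lambda>\<omega>. of_bool (E \<omega>) *\<^sub>R exp (\<i> * complex_of_real (\<alpha> * random_motion c N \<theta> t \<omega>))) \<in> borel_measurable M"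
    (is "?Z \<in> _")
    and "expectation (\<lambda>\<omega>. of_bool (E \<omega>) *\<^sub>R exp (\<i> * complex_of_real (\<alpha> * random_motion c N \<theta> t \<omega>)))
    = complex_of_real (exp (- (rate * t)) * rate ^ n * ordered_integral n 0 t (path_char (\<alpha> * c) t n))"
proof -
  define b where "b = \<alpha> * c"
  define Z where "Z m \<omega> = (\<Sum>i\<in>grid_maps n m.
      indicator (increment_event t m n i) \<omega> *\<^sub>R path_exp b t n (corner t m i) \<omega>)" for m \<omega>
  have indep: "indep_set (sets sigma_N) (sets sigma_\<theta>)"
    using indep_process_angles by (simp add: indep_elements_def)
  have ev [measurable]: "increment_event t m n i \<in> events" for m i
    using increment_event_sigma_N[OF assms(1)] indep_setD_ev1[OF indep] by blast
  have meas_pe [measurable]: "path_exp b t n y \<in> borel_measurable M" for y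
  proof -
    have "borel_measurable sigma_\<theta> \<subseteq> (borel_measurable M :: ('a \<Rightarrow> complex) set)"
      by (rule measurable_mono) (use indep_setD_ev2[OF indep] in auto)
    with path_exp_sigma_\<theta> show ?thesis by blast
  qed
  have [measurable]: "Z m \<in> borel_measurable M" for m
    unfolding Z_def[abs_def] by measurable
  have Z_grid: "Z m \<omega> = of_bool (N t \<omega> = n) *\<^sub>R
      grid_approx t m n (\<lambda>y. path_exp b t n y \<omega>) (\<lambda>j. event_time N j \<omega>)"
    if "\<omega> \<in> space M" "m > 0" for m \<omega>
    unfolding Z_def grid_approx_def scaleR_sum_right
    by (intro sum.cong refl) (use increment_event_iff[OF assms(1) that(2) _ that(1)] in \<open>auto simp: indicator_def\<close>)
  have lim: "(\<lambda>m. Z m \<omega>) \<longlonglongrightarrow> ?Z \<omega>" if "\<omega> \<in> space M" for \<omega>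
  proof -
    have "(\<lambda>m. of_bool (N t \<omega> = n) *\<^sub>R
        grid_approx t m n (\<lambda>y. path_exp b t n y \<omega>) (\<lambda>j. event_time N j \<omega>)) \<longlonglongrightarrow> ?Z \<omega>"
    proof (cases "N t \<omega> = n")
      case True
      have "(\<lambda>m. grid_approx t m n (\<lambda>y. path_exp b t n y \<omega>) (\<lambda>j. event_time N j \<omega>))
          \<longlonglongrightarrow> of_bool (strict_mono_on {1..n} (\<lambda>j. event_time N j \<omega>)) *\<^sub>R
            path_exp b t n (\<lambda>j. event_time N j \<omega>) \<omega>"
      proof (rule grid_approx_tendsto[OF assms(1) _ path_exp_tendsto])
        fix j assume j: "j \<in> {1..n}"
        \<comment> \<open>Comparing at the times 0 and \<open>t\<close>: level \<open>j\<close> is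
          not reached at 0, but it is reached at \<open>t\<close>.\<close>
        with event_time_le[OF that, of t j 0] event_time_le[OF that, of t j t] N_0[OF that] True assms(1)
        show "0 < event_time N j \<omega> \<and> event_time N j \<omega> \<le> t" by auto
      qed
      then show ?thesis
        using True by (simp add: E_def b_def path_exp_event_times)
    qed (simp add: E_def)
    then show ?thesis
      by (rule Lim_transform_eventually)
         (use Z_grid that in \<open>auto simp: eventually_sequentially intro!: exI[of _ 1]\<close>)
  qed
  \<comment> \<open>Measurability, including that of the ordering condition, is inherited from the
    approximations \<open>Z m\<close>.\<close>
  show meas: "?Z \<in> borel_measurable M"
    by (rule borel_measurable_LIMSEQ_metric[OF _ lim]) auto
  \<comment> \<open>The identity \<open>Z_grid\<close>, and with it the bound 1, requires at least
    one cell; hence the shift to \<open>Suc m\<close>.\<close>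
  have "(\<lambda>m. expectation (Z (Suc m))) \<longlonglongrightarrow> expectation ?Z"
  proof (rule integral_dominated_convergence[where w = "\<lambda>_. 1"])
    show "AE \<omega> in M. (\<lambda>m. Z (Suc m) \<omega>) \<longlonglongrightarrow> ?Z \<omega>"
      by (intro AE_I2 LIMSEQ_Suc lim)
    show "AE \<omega> in M. norm (Z (Suc m) \<omega>) \<le> 1" for m
    proof (intro AE_I2)
      fix \<omega> assume "\<omega> \<in> space M"
      then show "norm (Z (Suc m) \<omega>) \<le> 1"
        using norm_grid_approx_le[of "\<lambda>y. path_exp b t n y \<omega>" 1 t "Suc m" n "\<lambda>j. event_time N j \<omega>"]
        by (simp add: Z_grid norm_path_exp)
    qed
  qed (use meas in auto)
  then have "(\<lambda>m. expectation (Z m)) \<longlonglongrightarrow> expectation ?Z"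
    by (rule LIMSEQ_imp_Suc)
  moreover have "(\<lambda>m. expectation (Z m)) \<longlonglongrightarrow> complex_of_real
      (exp (- (rate * t)) * (rate * t) ^ n * (ordered_integral n 0 t (path_char b t n) / t ^ n))"
  proof (rule Lim_transform_eventually)
    show "(\<lambda>m. complex_of_real (exp (- (rate * t)) * (rate * t) ^ n *
        ((\<Sum>i\<in>grid_maps n m. path_char b t n (map (corner t m i) [1..<Suc n])) / real m ^ n)))
      \<longlonglongrightarrow> complex_of_real
      (exp (- (rate * t)) * (rate * t) ^ n * (ordered_integral n 0 t (path_char b t n) / t ^ n))"
      by (intro tendsto_of_real tendsto_mult_left path_char_grid_average assms)
    have Z_eq: "expectation (Z m) = complex_of_real (exp (- (rate * t)) * (rate * t) ^ n *
        ((\<Sum>i\<in>grid_maps n m. path_char b t n (map (corner t m i) [1..<Suc n])) / real m ^ n))"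
      if "m > 0" for m
    proof -
      have int: "integrable M (\<lambda>\<omega>. indicator (increment_event t m n i) \<omega> *\<^sub>R path_exp b t n (corner t m i) \<omega>)" for i
        by (rule integrable_const_bound[where B = 1]) (auto simp: norm_path_exp indicator_def)
      have "expectation (Z m) = (\<Sum>i\<in>grid_maps n m.
          prob (increment_event t m n i) *\<^sub>R expectation (path_exp b t n (corner t m i)))"
        unfolding Z_def Bochner_Integration.integral_sum[OF int]
      proof (intro sum.cong refl)
        show "expectation (\<lambda>\<omega>. indicator (increment_event t m n i) \<omega> *\<^sub>R path_exp b t n (corner t m i) \<omega>)
            = prob (increment_event t m n i) *\<^sub>R expectation (path_exp b t n (corner t m i))" for i
          by (rule expectation_indicator_indep[OF indep, where C = 1])
             (simp_all only: space_vimage_algebra increment_event_sigma_N[OF assms(1)]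
               path_exp_sigma_\<theta> norm_path_exp order_refl)
      qed
      also have "\<dots> = (\<Sum>i\<in>grid_maps n m. complex_of_real (exp (- (rate * t)) * (rate * t / real m) ^ n *
          path_char b t n (map (corner t m i) [1..<Suc n])))"
        by (intro sum.cong refl)
           (simp only: prob_increment_event[OF assms(1) that] expectation_path_exp path_char_map scaleR_conv_of_real of_real_mult)
      finally show ?thesis
        by (simp add: sum_distrib_left sum_divide_distrib power_divide mult_ac)
    qed
    show "\<forall>\<^sub>F m in sequentially. complex_of_real (exp (- (rate * t)) * (rate * t) ^ n *
        ((\<Sum>i\<in>grid_maps n m. path_char b t n (map (corner t m i) [1..<Suc n])) / real m ^ n)) = expectation (Z m)"
      using eventually_gt_at_top[of 0] by eventually_elim (simp only: Z_eq)
  qed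
  ultimately have "expectation ?Z = complex_of_real
      (exp (- (rate * t)) * (rate * t) ^ n * (ordered_integral n 0 t (path_char b t n) / t ^ n))"
    by (rule LIMSEQ_unique)
  then show "expectation ?Z = complex_of_real (exp (- (rate * t)) * rate ^ n * ordered_integral n 0 t (path_char (\<alpha> * c) t n))"
    using assms(1) by (simp add: power_mult_distrib b_def)
qed

text \<open>With \<alpha> = 0 the preceding identity gives the probability of \<open>N t = n\<close>
  with ordered event times. It equals the Poisson weight of \<open>N t = n\<close>, and nested
  events of equal probability differ by a null set.\<close>

lemma AE_strict_mono_event_times:
  assumes "t > 0"
  shows "AE \<omega> in M. N t \<omega> = n \<longrightarrow> strict_mono_on {1..n} (\<lambda>j. event_time N j \<omega>)"
proof -
  define E where "E = {\<omega> \<in> space M. N t \<omega> = n \<and> strict_mono_on {1..n} (\<lambda>j. event_time N j \<omega>)}"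
  have N [measurable]: "N t \<in> M \<rightarrow>\<^sub>M count_space UNIV" using assms by (intro measurable_N) auto
  define f :: "'a \<Rightarrow> complex" where "f \<omega> = of_bool (N t \<omega> = n \<and> strict_mono_on {1..n} (\<lambda>j. event_time N j \<omega>))" for \<omega>
  have f_eq: "of_bool (N t \<omega> = n \<and> strict_mono_on {1..n} (\<lambda>j. event_time N j \<omega>)) *\<^sub>R
      exp (\<i> * complex_of_real (0 * random_motion 0 N \<theta> t \<omega>)) = f \<omega>" for \<omega>
    by (simp add: f_def)
  have f [measurable]: "f \<in> borel_measurable M"
    using expectation_ordered_event_times(1)[OF assms, of n 0 0] by (simp only: f_eq)
  have E: "E \<in> events"
  proof -
    have "f -` {1} \<inter> space M \<in> events" by measurable
    also have "f -` {1} \<inter> space M = E" by (auto simp: f_def E_def split: if_splits)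
    finally show ?thesis .
  qed
  have one: "angle_char 0 = 1"
  proof -
    have "complex_of_real (angle_char 0) = 1"
      using expectation_angle[OF order_refl, of 0] by (simp add: prob_space)
    then show ?thesis by simp
  qed
  have "complex_of_real (prob E) = expectation (\<lambda>\<omega>. complex_of_real (indicator E \<omega>))"
    using E by (simp add: sets.Int_space_eq2)
  also have "\<dots> = expectation f"
    by (intro Bochner_Integration.integral_cong) (auto simp: E_def f_def)
  also have "\<dots> = complex_of_real (exp (- (rate * t)) * rate ^ n * ordered_integral n 0 t (path_char 0 t n))"
    using expectation_ordered_event_times(2)[OF assms, of n 0 0, unfolded f_eq] by (simp only: mult_zero_left)
  also have "path_char 0 t n = (\<lambda>_. 1)"
    by (simp add: path_char_def fun_eq_iff one)
  also have "exp (- (rate * t)) * rate ^ n * ordered_integral n 0 t (\<lambda>_. 1) = prob {\<omega> \<in> space M. N t \<omega> = n}"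
    using assms by (simp add: ordered_integral_one prob_N_eq power_mult_distrib)
  finally have eq: "prob E = prob {\<omega> \<in> space M. N t \<omega> = n}" by simp
  have "prob ({\<omega> \<in> space M. N t \<omega> = n} - E) = 0"
    using E eq by (subst finite_measure_Diff) (auto simp: E_def)
  moreover have "{\<omega> \<in> space M. N t \<omega> = n} - E \<in> events" using E by measurable
  ultimately have "AE \<omega> in M. \<omega> \<notin> {\<omega> \<in> space M. N t \<omega> = n} - E"
    by (simp add: prob_eq_0)
  then show ?thesis
    by (rule AE_mp) (auto simp: E_def)
qed

text \<open>Dividing by the probability of \<open>N t = n\<close> cancels the exponential and the
  powers of \<open>rate\<close>, leaving \<open>fact n / t ^ n\<close>.\<close>

lemma cond_expectation_random_motion:
  assumes "t > 0"
  shows "cond_expectation M (\<lambda>\<omega>. exp (\<i> * complex_of_real (\<alpha> * random_motion c N \<theta> t \<omega>))) {\<omega> \<in> space M. N t \<omega> = n}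
    = complex_of_real (fact n / t ^ n * ordered_integral n 0 t (path_char (\<alpha> * c) t n))"
proof -
  define A where "A = {\<omega> \<in> space M. N t \<omega> = n}"
  define Y where "Y \<omega> = exp (\<i> * complex_of_real (\<alpha> * random_motion c N \<theta> t \<omega>))" for \<omega>
  have [measurable]: "N t \<in> M \<rightarrow>\<^sub>M count_space UNIV" using assms by (intro measurable_N) auto
  have [measurable]: "random_motion c N \<theta> t \<in> borel_measurable M" by (rule measurable_random_motion[OF assms])
  have A [measurable]: "A \<in> events" unfolding A_def by measurable
  have [measurable]: "Y \<in> borel_measurable M" unfolding Y_def[abs_def] by measurable
  have prob_A: "prob A = exp (- (rate * t)) * (rate * t) ^ n / fact n"
    unfolding A_def by (rule prob_N_eq[OF assms])
  have pos: "prob A > 0" unfolding prob_A using assms rate_pos by simp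
  have "uniform_measure M A = density M (\<lambda>\<omega>. ennreal (indicator A \<omega> / prob A))"
    unfolding uniform_measure_def using pos
    by (intro density_cong) (auto split: split_indicator simp: emeasure_eq_measure divide_ennreal ennreal_1[symmetric] simp del: ennreal_1)
  then have "cond_expectation M Y A = expectation (\<lambda>\<omega>. (indicator A \<omega> / prob A) *\<^sub>R Y \<omega>)"
    unfolding cond_expectation_def using pos by (simp add: integral_density)
  \<comment> \<open>The ordering condition can be inserted because it holds almost surely on
    \<open>A\<close>.\<close>
  also have "\<dots> = expectation (\<lambda>\<omega>. (1 / prob A) *\<^sub>R (of_bool (N t \<omega> = n \<and> strict_mono_on {1..n} (\<lambda>j. event_time N j \<omega>)) *\<^sub>R Y \<omega>))"
  proof (rule integral_cong_AE)
    show "(\<lambda>\<omega>. (1 / prob A) *\<^sub>R (of_bool (N t \<omega> = n \<and> strict_mono_on {1..n} (\<lambda>j. event_time N j \<omega>)) *\<^sub>R Y \<omega>)) \<in> borel_measurable M"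
      unfolding Y_def by (intro borel_measurable_scaleR borel_measurable_const expectation_ordered_event_times assms)
    show "AE \<omega> in M. (indicator A \<omega> / prob A) *\<^sub>R Y \<omega>
        = (1 / prob A) *\<^sub>R (of_bool (N t \<omega> = n \<and> strict_mono_on {1..n} (\<lambda>j. event_time N j \<omega>)) *\<^sub>R Y \<omega>)"
      using AE_strict_mono_event_times[OF assms, of n] AE_space
      by eventually_elim (auto simp: A_def indicator_def)
  qed measurable
  also have "\<dots> = (1 / prob A) *\<^sub>R complex_of_real (exp (- (rate * t)) * rate ^ n * ordered_integral n 0 t (path_char (\<alpha> * c) t n))"
    unfolding Y_def integral_scaleR_right expectation_ordered_event_times(2)[OF assms] ..
  also have "\<dots> = complex_of_real (1 / prob A * (exp (- (rate * t)) * rate ^ n * ordered_integral n 0 t (path_char (\<alpha> * c) t n)))"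
    by (simp only: scaleR_conv_of_real of_real_mult)
  also have "1 / prob A * (exp (- (rate * t)) * rate ^ n * ordered_integral n 0 t (path_char (\<alpha> * c) t n))
      = fact n / t ^ n * ordered_integral n 0 t (path_char (\<alpha> * c) t n)"
    unfolding prob_A using assms rate_pos by (simp add: power_mult_distrib)
  finally show ?thesis by (simp only: A_def Y_def[abs_def])
qed

end

theorem theorem2p1:
  fixes M :: "'a measure" and N :: "real \<Rightarrow> 'a \<Rightarrow> nat" and \<theta> :: "nat \<Rightarrow> 'a \<Rightarrow> real"
    and c rate \<nu> t \<alpha> :: real
  assumes "c > 0" and "rate > 0" and "\<nu> \<ge> 0" and "t > 0"
    and "prob_space M"
    and "poisson_process M rate N"
    and "prob_space.indep_vars M (\<lambda>_. borel) \<theta> {1..}"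
    and "\<And>j. j \<ge> 1 \<Longrightarrow> distributed M lborel (\<theta> j) (\<lambda>x. ennreal (angle_density \<nu> x))"
    and "indep_elements M
           (Pi\<^sub>M {0..} (\<lambda>_. count_space UNIV)) (\<lambda>\<omega>. \<lambda>u\<in>{0..}. N u \<omega>)
           (Pi\<^sub>M {1..} (\<lambda>_. borel)) (\<lambda>\<omega>. \<lambda>j\<in>{1..}. \<theta> j \<omega>)"
  shows "(\<forall>n\<ge>1.
            cond_expectation M (\<lambda>\<omega>. exp (\<i> * complex_of_real (\<alpha> * random_motion c N \<theta> t \<omega>)))
              {\<omega> \<in> space M. N t \<omega> = n}
            = complex_of_real (fact n / t ^ n * (2 powr \<nu> * Gamma (\<nu> + 1)) ^ (n + 1) *
                ordered_integral n 0 t (\<lambda>xs. let s = (\<lambda>j. (0 # xs @ [t]) ! j) in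
                  \<Prod>j=1..n + 1. bessel_J_quot \<nu> (\<alpha> * c * (s j - s (j - 1)))))) \<and>
         cond_expectation M (\<lambda>\<omega>. exp (\<i> * complex_of_real (\<alpha> * random_motion c N \<theta> t \<omega>)))
              {\<omega> \<in> space M. N t \<omega> = 0}
            = complex_of_real (2 powr \<nu> * Gamma (\<nu> + 1) * bessel_J_quot \<nu> (\<alpha> * c * t))"
proof -
  interpret prob_space M by fact
  interpret poisson_flight M N \<theta> rate \<nu>
    by unfold_locales (use assms in auto)
  have "path_char (\<alpha> * c) t n = (\<lambda>xs. (2 powr \<nu> * Gamma (\<nu> + 1)) ^ (n + 1) *
      (let s = (\<lambda>j. (0 # xs @ [t]) ! j) in
        \<Prod>j=1..n + 1. bessel_J_quot \<nu> (\<alpha> * c * (s j - s (j - 1)))))" for n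
    unfolding path_char_def angle_char_def Let_def prod.distrib prod_constant card_atLeastAtMost
    by (simp add: power_mult_distrib mult_ac)
  then have eq: "ordered_integral n 0 t (path_char (\<alpha> * c) t n) = (2 powr \<nu> * Gamma (\<nu> + 1)) ^ (n + 1) *
      ordered_integral n 0 t (\<lambda>xs. let s = (\<lambda>j. (0 # xs @ [t]) ! j) in
        \<Prod>j=1..n + 1. bessel_J_quot \<nu> (\<alpha> * c * (s j - s (j - 1))))" for n
    by (simp only: ordered_integral_cmult)
  \<comment> \<open>Both clauses are the same formula: for \<open>n = 0\<close> nothing is
    integrated and the partition 0, \<open>t\<close> contributes a single factor.\<close>
  show ?thesis
    unfolding cond_expectation_random_motion[OF \<open>t > 0\<close>] eq
    by (intro conjI allI impI) (simp_all only: mult.assoc, simp)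
qed

end
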